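(* Let $D$ be a free domain and let $\phi$ be a meromorphic function on $D$, with singular set $S$. Then $\phi$ is free holomorphic off its singular set: every point $M\in D\setminus S$ lies in a basic free open set $G_\delta\subseteq D\setminus S$ on which $\phi$ is a bounded nc-function.
   Context: $\mathcal M^d=\bigcup_n\mathcal M_n^d$ ($d$-tuples of $n\times n$ complex matrices). For a matrix $\delta$ of free polynomials, $G_\delta=\{M\in\mathcal M^d:\|\delta(M)\|<1\}$ (basic free open set); the free topology has these as a basis, and a free domain is a free-open set. An nc-function on a set closed under direct sums and unitary conjugation is a graded map $\phi$ ($\phi(x)\in\mathcal M_n$ for $x\in\mathcal M_n^d$) with $\phi(x\oplus y)=\phi(x)\oplus\phi(y)$ and $\phi(s^{-1}xs)=s^{-1}\phi(x)s$ whenever defined. A free holomorphic function on a free domain $D$ is a function such that every $M\in D$ lies in some $G_\delta\subseteq D$ on which it is a bounded nc-function. A meromorphic function on $D$ is any function built from free holomorphic functions on $D$ by finitely many arithmetic operations (addition, multiplication, scalar multiplication, and inversion $x\mapsto \psi(x)^{-1}$), taken with a fixed such presentation; its singular set is the set of $x\in D$ at which, at some stage of evaluating $\phi(x)$ via this presentation, one must invert a matrix that is not invertible. *)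

theory Defs
  imports Complex_Main "Jordan_Normal_Form.Matrix"
begin

type_synonym point = "nat \<times> complex mat list"

definition Md :: "nat \<Rightarrow> point set" where
  "Md d = {(n, X). n \<ge> 1 \<and> length X = d \<and> (\<forall>A\<in>set X. A \<in> carrier_mat n n)}"

datatype fpoly = FVar nat | FConst complex | FAdd fpoly fpoly | FMul fpoly fpoly

fun fpeval :: "fpoly \<Rightarrow> point \<Rightarrow> complex mat" where
  "fpeval (FVar i) (n, X) = (if i < length X then X ! i else 0\<^sub>m n n)"
| "fpeval (FConst c) (n, X) = c \<cdot>\<^sub>m 1\<^sub>m n"
| "fpeval (FAdd p q) x = fpeval p x + fpeval q x"
| "fpeval (FMul p q) x = fpeval p x * fpeval q x"

(* evaluation of a J x K matrix of free polynomials: the (J n) x (K n) block matrix *)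
definition fpmat_eval :: "fpoly mat \<Rightarrow> point \<Rightarrow> complex mat" where
  "fpmat_eval \<delta> x = (let n = fst x in
     mat (dim_row \<delta> * n) (dim_col \<delta> * n)
       (\<lambda>(i, j). fpeval (\<delta> $$ (i div n, j div n)) x $$ (i mod n, j mod n)))"

definition vnorm :: "complex vec \<Rightarrow> real" where
  "vnorm v = sqrt (\<Sum>i<dim_vec v. (cmod (v $ i))\<^sup>2)"

definition opnorm :: "complex mat \<Rightarrow> real" where
  "opnorm A = Sup {vnorm (A *\<^sub>v v) | v. v \<in> carrier_vec (dim_col A) \<and> vnorm v \<le> 1}"

definition G :: "nat \<Rightarrow> fpoly mat \<Rightarrow> point set" where
  "G d \<delta> = {x \<in> Md d. opnorm (fpmat_eval \<delta> x) < 1}"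

definition free_domain :: "nat \<Rightarrow> point set \<Rightarrow> bool" where
  "free_domain d D \<longleftrightarrow> D \<subseteq> Md d \<and> (\<forall>x\<in>D. \<exists>\<delta>. x \<in> G d \<delta> \<and> G d \<delta> \<subseteq> D)"

definition diag_mat :: "complex mat \<Rightarrow> complex mat \<Rightarrow> complex mat" where
  "diag_mat A B = four_block_mat A (0\<^sub>m (dim_row A) (dim_col B)) (0\<^sub>m (dim_row B) (dim_col A)) B"

definition dsum :: "point \<Rightarrow> point \<Rightarrow> point" where
  "dsum x y = (fst x + fst y, map2 diag_mat (snd x) (snd y))"

(* s^{-1} x s, where t = s^{-1} *)
definition simil :: "complex mat \<Rightarrow> complex mat \<Rightarrow> point \<Rightarrow> point" where
  "simil t s x = (fst x, map (\<lambda>A. t * A * s) (snd x))"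

definition nc_function :: "point set \<Rightarrow> (point \<Rightarrow> complex mat) \<Rightarrow> bool" where
  "nc_function \<Omega> \<phi> \<longleftrightarrow>
     (\<forall>x\<in>\<Omega>. \<phi> x \<in> carrier_mat (fst x) (fst x)) \<and>
     (\<forall>x\<in>\<Omega>. \<forall>y\<in>\<Omega>. dsum x y \<in> \<Omega> \<longrightarrow> \<phi> (dsum x y) = diag_mat (\<phi> x) (\<phi> y)) \<and>
     (\<forall>x\<in>\<Omega>. \<forall>s t. s \<in> carrier_mat (fst x) (fst x) \<and> t \<in> carrier_mat (fst x) (fst x) \<and>
        t * s = 1\<^sub>m (fst x) \<and> s * t = 1\<^sub>m (fst x) \<and> simil t s x \<in> \<Omega> \<longrightarrow>
        \<phi> (simil t s x) = t * \<phi> x * s)"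

definition bounded_on :: "point set \<Rightarrow> (point \<Rightarrow> complex mat) \<Rightarrow> bool" where
  "bounded_on \<Omega> \<phi> \<longleftrightarrow> (\<exists>C. \<forall>x\<in>\<Omega>. opnorm (\<phi> x) \<le> C)"

definition free_holomorphic :: "nat \<Rightarrow> point set \<Rightarrow> (point \<Rightarrow> complex mat) \<Rightarrow> bool" where
  "free_holomorphic d D \<phi> \<longleftrightarrow>
     (\<forall>M\<in>D. \<exists>\<delta>. M \<in> G d \<delta> \<and> G d \<delta> \<subseteq> D \<and> nc_function (G d \<delta>) \<phi> \<and> bounded_on (G d \<delta>) \<phi>)"

datatype mexpr = MHol "point \<Rightarrow> complex mat" | MAdd mexpr mexpr | MMul mexpr mexpr
  | MScal complex mexpr | MInv mexpr

fun leaves :: "mexpr \<Rightarrow> (point \<Rightarrow> complex mat) set" where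
  "leaves (MHol f) = {f}"
| "leaves (MAdd a b) = leaves a \<union> leaves b"
| "leaves (MMul a b) = leaves a \<union> leaves b"
| "leaves (MScal c a) = leaves a"
| "leaves (MInv a) = leaves a"

definition is_meromorphic :: "nat \<Rightarrow> point set \<Rightarrow> mexpr \<Rightarrow> bool" where
  "is_meromorphic d D e \<longleftrightarrow> free_domain d D \<and> (\<forall>f\<in>leaves e. free_holomorphic d D f)"

definition mat_inv :: "complex mat \<Rightarrow> complex mat" where
  "mat_inv A = (THE B. B \<in> carrier_mat (dim_row A) (dim_row A) \<and>
                       A * B = 1\<^sub>m (dim_row A) \<and> B * A = 1\<^sub>m (dim_row A))"

fun meval :: "mexpr \<Rightarrow> point \<Rightarrow> complex mat option" where
  "meval (MHol f) x = Some (f x)"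
| "meval (MAdd a b) x = (case (meval a x, meval b x) of (Some A, Some B) \<Rightarrow> Some (A + B) | _ \<Rightarrow> None)"
| "meval (MMul a b) x = (case (meval a x, meval b x) of (Some A, Some B) \<Rightarrow> Some (A * B) | _ \<Rightarrow> None)"
| "meval (MScal c a) x = map_option (\<lambda>A. c \<cdot>\<^sub>m A) (meval a x)"
| "meval (MInv a) x = (case meval a x of Some A \<Rightarrow>
       (if invertible_mat A then Some (mat_inv A) else None) | None \<Rightarrow> None)"

definition singular_set :: "point set \<Rightarrow> mexpr \<Rightarrow> point set" where
  "singular_set D e = {x \<in> D. meval e x = None}"

(* the function phi determined by the presentation (meaningful off the singular set) *)
definition mfun :: "mexpr \<Rightarrow> point \<Rightarrow> complex mat" where
  "mfun e x = (case meval e x of Some A \<Rightarrow> A | None \<Rightarrow> 0\<^sub>m (fst x) (fst x))"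

end

theory Submission
  imports Defs "Jordan_Normal_Form.Determinant" "HOL-Analysis.L2_Norm"
begin

text \<open>
  The only hard step is inversion: a bounded nc function \<open>\<psi>\<close> on \<open>G\<^sub>\<delta>\<close> with \<open>\<psi>(M)\<close> invertible must have a
  bounded inverse on a smaller basic set around \<open>M\<close>. Choose polynomials \<open>w\<^sub>1, \<dots>, w\<^sub>r\<close> whose values at \<open>M\<close>
  are an orthonormal basis (for the Frobenius inner product) of the algebra generated by \<open>M\<close>, and let \<open>N\<close>
  be the \<open>r \<times> r\<close> point given by left multiplication by \<open>M\<close> on that algebra. It is the restriction of copies
  of \<open>M\<close> to an invariant subspace, so \<open>\<parallel>\<delta>(N)\<parallel> \<le> \<parallel>\<delta>(M)\<parallel>\<close> and \<open>\<psi>(N)\<close> is invertible. For a point \<open>x\<close> and a vector \<open>v\<close>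
  the map \<open>L : e\<^sub>j \<mapsto> w\<^sub>j(x) v\<close> satisfies \<open>p(x) L \<approx> L p(N)\<close> as soon as finitely many polynomials vanishing at \<open>M\<close>
  are small at \<open>x\<close>. Then the point with upper triangular blocks \<open>x, c (x L - L N), N\<close>, which is similar to
  \<open>x \<oplus> N\<close>, still lies in \<open>G\<^sub>\<delta>\<close>, and the bound on \<open>\<psi>\<close> there gives \<open>\<parallel>\<psi>(x) L - L \<psi>(N)\<parallel> \<le> C / c\<close>. Evaluating at
  \<open>\<psi>(N)\<^sup>-\<^sup>1 1\<close> yields a polynomial \<open>q\<close> with \<open>\<psi>(x) q(x) \<approx> 1\<close>, uniformly in the size of \<open>x\<close>.
\<close>


section \<open>Euclidean norm and operator norm\<close>

lemma vnorm_L2_set: "vnorm v = L2_set (\<lambda>i. cmod (v $ i)) {..<dim_vec v}"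
  by (simp add: vnorm_def L2_set_def)

lemma vnorm_nonneg [simp]: "0 \<le> vnorm v"
  by (simp add: vnorm_L2_set)

lemma vnorm_eq_0_iff:
  assumes "v \<in> carrier_vec n"
  shows "vnorm v = 0 \<longleftrightarrow> v = 0\<^sub>v n"
  using assms by (auto simp: vnorm_L2_set L2_set_eq_0_iff intro!: eq_vecI)

lemma vnorm_smult [simp]: "vnorm (c \<cdot>\<^sub>v v) = cmod c * vnorm v"
  by (auto simp: vnorm_L2_set norm_mult L2_set_right_distrib intro!: L2_set_cong)

lemma vnorm_zero [simp]: "vnorm (0\<^sub>v n) = 0"
  by (simp add: vnorm_L2_set L2_set_eq_0_iff)

lemma L2_set_cmod_triangle:
  "L2_set (\<lambda>i. cmod (f i + g i)) A \<le> L2_set (\<lambda>i. cmod (f i)) A + L2_set (\<lambda>i. cmod (g i)) A"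
proof -
  have "L2_set (\<lambda>i. cmod (f i + g i)) A \<le> L2_set (\<lambda>i. cmod (f i) + cmod (g i)) A"
    by (rule L2_set_mono) (auto intro: norm_triangle_ineq)
  also have "\<dots> \<le> L2_set (\<lambda>i. cmod (f i)) A + L2_set (\<lambda>i. cmod (g i)) A"
    by (rule L2_set_triangle_ineq)
  finally show ?thesis .
qed

lemma vnorm_triangle:
  assumes "v \<in> carrier_vec n" "w \<in> carrier_vec n"
  shows "vnorm (v + w) \<le> vnorm v + vnorm w"
proof -
  have "vnorm (v + w) = L2_set (\<lambda>i. cmod (v $ i + w $ i)) {..<n}"
    using assms by (auto simp: vnorm_L2_set intro!: L2_set_cong)
  also have "\<dots> \<le> vnorm v + vnorm w"
    using L2_set_cmod_triangle[of "\<lambda>i. v $ i" "\<lambda>i. w $ i" "{..<n}"] assms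
    by (simp add: vnorm_L2_set)
  finally show ?thesis .
qed

lemma vnorm_diff_triangle:
  assumes "v \<in> carrier_vec n" "w \<in> carrier_vec n" "z \<in> carrier_vec n"
  shows "vnorm (v - z) \<le> vnorm (v - w) + vnorm (w - z)"
proof -
  have "v - z = (v - w) + (w - z)" using assms by (intro eq_vecI) auto
  then show ?thesis using vnorm_triangle[of "v - w" n "w - z"] assms by auto
qed

lemma sum_lessThan_add:
  fixes f :: "nat \<Rightarrow> 'a :: comm_monoid_add"
  shows "(\<Sum>i<n + k. f i) = (\<Sum>i<n. f i) + (\<Sum>i<k. f (n + i))"
  by (induction k) (simp_all add: add.assoc)

lemma vnorm_append_sq:
  "(vnorm (v @\<^sub>v w))\<^sup>2 = (vnorm v)\<^sup>2 + (vnorm w)\<^sup>2"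
proof -
  have "(\<Sum>i<dim_vec v + dim_vec w. (cmod ((v @\<^sub>v w) $ i))\<^sup>2)
      = (\<Sum>i<dim_vec v. (cmod ((v @\<^sub>v w) $ i))\<^sup>2)
        + (\<Sum>i<dim_vec w. (cmod ((v @\<^sub>v w) $ (i + dim_vec v)))\<^sup>2)"
    by (simp add: sum_lessThan_add add.commute)
  then show ?thesis
    by (simp add: vnorm_def sum_nonneg)
qed

text \<open>Bounds are handled through this inequality, because \<open>opnorm\<close> is a supremum
  and awkward to compute with. The conjunct \<open>0 \<le> C\<close> also excludes negative
  constants for a matrix without columns, where the inequality alone would allow them.\<close>

definition op_bound :: "complex mat \<Rightarrow> real \<Rightarrow> bool" where
  "op_bound A C \<longleftrightarrow> 0 \<le> C \<and> (\<forall>v \<in> carrier_vec (dim_col A). vnorm (A *\<^sub>v v) \<le> C * vnorm v)"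

lemma op_boundD: "op_bound A C \<Longrightarrow> v \<in> carrier_vec (dim_col A) \<Longrightarrow> vnorm (A *\<^sub>v v) \<le> C * vnorm v"
  by (simp add: op_bound_def)

lemma op_bound_mono: "op_bound A C \<Longrightarrow> C \<le> C' \<Longrightarrow> op_bound A C'"
  unfolding op_bound_def by (meson mult_right_mono order_trans vnorm_nonneg)

text \<open>A crude constant suffices, the sum of the moduli of all entries: it serves to show that
  the supremum in \<open>opnorm\<close> is taken over a set bounded above.\<close>

lemma op_bound_exists: "\<exists>C. op_bound A C"
proof -
  let ?C = "\<Sum>i<dim_row A. \<Sum>j<dim_col A. cmod (A $$ (i, j))"
  have "vnorm (A *\<^sub>v v) \<le> ?C * vnorm v" if v: "v \<in> carrier_vec (dim_col A)" for v
  proof -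
    have "vnorm (A *\<^sub>v v) \<le> (\<Sum>i<dim_row A. cmod ((A *\<^sub>v v) $ i))"
      using L2_set_le_sum[of "{..<dim_row A}" "\<lambda>i. cmod ((A *\<^sub>v v) $ i)"] by (simp add: vnorm_L2_set)
    also have "\<dots> \<le> (\<Sum>i<dim_row A. \<Sum>j<dim_col A. cmod (A $$ (i, j)) * vnorm v)"
    proof (rule sum_mono)
      fix i assume i: "i \<in> {..<dim_row A}"
      have "cmod ((A *\<^sub>v v) $ i) = cmod (\<Sum>j<dim_col A. A $$ (i, j) * v $ j)"
        using i v by (simp add: scalar_prod_def lessThan_atLeast0)
      also have "\<dots> \<le> (\<Sum>j<dim_col A. cmod (A $$ (i, j) * v $ j))"
        by (rule norm_sum)
      also have "\<dots> \<le> (\<Sum>j<dim_col A. cmod (A $$ (i, j)) * vnorm v)"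
        using v by (intro sum_mono) (auto simp: norm_mult vnorm_L2_set intro!: mult_left_mono
            member_le_L2_set[of "{..<dim_col A}" _ "\<lambda>j. cmod (v $ j)"])
      finally show "cmod ((A *\<^sub>v v) $ i) \<le> (\<Sum>j<dim_col A. cmod (A $$ (i, j)) * vnorm v)" .
    qed
    finally show ?thesis by (simp add: sum_distrib_right)
  qed
  then show ?thesis unfolding op_bound_def by (intro exI[of _ ?C]) (auto intro!: sum_nonneg)
qed

lemma op_bound_imp_opnorm_le:
  assumes "op_bound A C"
  shows "opnorm A \<le> C"
  unfolding opnorm_def
proof (rule cSup_least)
  have "vnorm (0\<^sub>v (dim_col A)) \<le> 1" by simp
  then show "{vnorm (A *\<^sub>v v) |v. v \<in> carrier_vec (dim_col A) \<and> vnorm v \<le> 1} \<noteq> {}"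
    using zero_carrier_vec by blast
next
  fix y assume "y \<in> {vnorm (A *\<^sub>v v) |v. v \<in> carrier_vec (dim_col A) \<and> vnorm v \<le> 1}"
  then obtain v where v: "v \<in> carrier_vec (dim_col A)" "vnorm v \<le> 1" "y = vnorm (A *\<^sub>v v)" by auto
  have "y \<le> C * vnorm v" using assms v by (simp add: op_bound_def)
  also have "\<dots> \<le> C * 1" using assms v by (intro mult_left_mono) (auto simp: op_bound_def)
  finally show "y \<le> C" by simp
qed

text \<open>The supremum runs over the unit ball, and homogeneity carries it to all vectors: a
  nonzero \<open>v\<close> is rescaled to norm 1, and for \<open>v\<close> of norm 0 both sides
  vanish.\<close>

lemma op_bound_opnorm: "op_bound A (opnorm A)"
proof -
  let ?S = "{vnorm (A *\<^sub>v v) |v. v \<in> carrier_vec (dim_col A) \<and> vnorm v \<le> 1}"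
  obtain C where C: "op_bound A C" using op_bound_exists by blast
  have bdd: "bdd_above ?S"
  proof (rule bdd_aboveI[of _ C])
    fix y assume "y \<in> ?S"
    then obtain v where v: "v \<in> carrier_vec (dim_col A)" "vnorm v \<le> 1" "y = vnorm (A *\<^sub>v v)" by auto
    have "y \<le> C * vnorm v" using C v by (simp add: op_bound_def)
    also have "\<dots> \<le> C * 1" using C v by (intro mult_left_mono) (auto simp: op_bound_def)
    finally show "y \<le> C" by simp
  qed
  have le: "vnorm (A *\<^sub>v v) \<le> opnorm A" if "v \<in> carrier_vec (dim_col A)" "vnorm v \<le> 1" for v
    unfolding opnorm_def using that by (intro cSup_upper bdd) auto
  have "vnorm (0\<^sub>v (dim_col A)) \<le> 1" by simp
  from le[OF _ this] have nn: "0 \<le> opnorm A"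
    using vnorm_nonneg order_trans zero_carrier_vec by blast
  moreover have "vnorm (A *\<^sub>v v) \<le> opnorm A * vnorm v" if v: "v \<in> carrier_vec (dim_col A)" for v
  proof (cases "vnorm v = 0")
    case True
    then have "v = 0\<^sub>v (dim_col A)" using v vnorm_eq_0_iff by blast
    then have "A *\<^sub>v v = 0\<^sub>v (dim_row A)" by auto
    then show ?thesis using True by simp
  next
    case False
    then have pos: "vnorm v > 0" by (simp add: order_less_le)
    let ?c = "complex_of_real (1 / vnorm v)"
    have "vnorm (A *\<^sub>v (?c \<cdot>\<^sub>v v)) \<le> opnorm A"
      using v pos by (intro le) (auto simp: norm_divide)
    moreover have "A *\<^sub>v (?c \<cdot>\<^sub>v v) = ?c \<cdot>\<^sub>v (A *\<^sub>v v)"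
      using v by (intro mult_mat_vec) auto
    ultimately show ?thesis using pos by (simp add: norm_divide field_simps)
  qed
  ultimately show ?thesis by (simp add: op_bound_def)
qed

lemma opnorm_le_iff: "0 \<le> C \<Longrightarrow> opnorm A \<le> C \<longleftrightarrow> op_bound A C"
  using op_bound_imp_opnorm_le op_bound_opnorm op_bound_mono by blast

lemma opnorm_nonneg: "0 \<le> opnorm A"
  using op_bound_opnorm by (simp add: op_bound_def)

lemma op_bound_add:
  assumes "A \<in> carrier_mat n m" "B \<in> carrier_mat n m" "op_bound A a" "op_bound B b"
  shows "op_bound (A + B) (a + b)"
  unfolding op_bound_def
proof (intro conjI ballI)
  show "0 \<le> a + b" using assms by (simp add: op_bound_def)
  fix v :: "complex vec" assume "v \<in> carrier_vec (dim_col (A + B))"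
  then have v: "v \<in> carrier_vec m" using assms by auto
  have "vnorm ((A + B) *\<^sub>v v) = vnorm (A *\<^sub>v v + B *\<^sub>v v)"
    using add_mult_distrib_mat_vec[OF assms(1,2) v] by simp
  also have "\<dots> \<le> vnorm (A *\<^sub>v v) + vnorm (B *\<^sub>v v)"
    using assms v by (intro vnorm_triangle[of _ n]) auto
  also have "\<dots> \<le> a * vnorm v + b * vnorm v"
    using assms v by (intro add_mono op_boundD) auto
  finally show "vnorm ((A + B) *\<^sub>v v) \<le> (a + b) * vnorm v" by (simp add: algebra_simps)
qed

lemma op_bound_mult:
  assumes "A \<in> carrier_mat n m" "B \<in> carrier_mat m k" "op_bound A a" "op_bound B b"
  shows "op_bound (A * B) (a * b)"
  unfolding op_bound_def
proof (intro conjI ballI)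
  show "0 \<le> a * b" using assms by (simp add: op_bound_def)
  fix v :: "complex vec" assume "v \<in> carrier_vec (dim_col (A * B))"
  then have v: "v \<in> carrier_vec k" using assms by auto
  have "vnorm ((A * B) *\<^sub>v v) = vnorm (A *\<^sub>v (B *\<^sub>v v))"
    using assoc_mult_mat_vec[OF assms(1,2) v] by simp
  also have "\<dots> \<le> a * vnorm (B *\<^sub>v v)"
    using assms v by (intro op_boundD) auto
  also have "\<dots> \<le> a * (b * vnorm v)"
    using assms v by (intro mult_left_mono op_boundD) (auto simp: op_bound_def)
  finally show "vnorm ((A * B) *\<^sub>v v) \<le> a * b * vnorm v" by (simp add: algebra_simps)
qed

lemma op_bound_smult:
  assumes "op_bound A a"
  shows "op_bound (c \<cdot>\<^sub>m A) (cmod c * a)"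
  unfolding op_bound_def
proof (intro conjI ballI)
  show "0 \<le> cmod c * a" using assms by (simp add: op_bound_def)
  fix v :: "complex vec" assume "v \<in> carrier_vec (dim_col (c \<cdot>\<^sub>m A))"
  then have v: "v \<in> carrier_vec (dim_col A)" by simp
  have "(c \<cdot>\<^sub>m A) *\<^sub>v v = c \<cdot>\<^sub>v (A *\<^sub>v v)" using v by (intro eq_vecI) auto
  then show "vnorm ((c \<cdot>\<^sub>m A) *\<^sub>v v) \<le> cmod c * a * vnorm v"
    using op_boundD[OF assms v] by (simp add: mult_left_mono mult.assoc)
qed

section \<open>Invertible matrices\<close>

text \<open>A two-sided inverse is unique, since
  \<open>B' = (B * A) * B' = B * (A * B') = B\<close>; hence the definite description in
  \<open>mat_inv\<close> denotes \<open>B\<close>.\<close>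

lemma mat_inv_eqI:
  assumes "A \<in> carrier_mat n n" "B \<in> carrier_mat n n" "A * B = 1\<^sub>m n" "B * A = 1\<^sub>m n"
  shows "mat_inv A = B"
  unfolding mat_inv_def
proof (rule the_equality)
  show "B \<in> carrier_mat (dim_row A) (dim_row A) \<and> A * B = 1\<^sub>m (dim_row A) \<and> B * A = 1\<^sub>m (dim_row A)"
    using assms by auto
next
  fix B' assume "B' \<in> carrier_mat (dim_row A) (dim_row A) \<and> A * B' = 1\<^sub>m (dim_row A) \<and> B' * A = 1\<^sub>m (dim_row A)"
  then have B': "B' \<in> carrier_mat n n" "A * B' = 1\<^sub>m n" using assms by auto
  have "B' = (B * A) * B'" using B' assms by simp
  also have "\<dots> = B * (A * B')" using B' assms by (intro assoc_mult_mat) auto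
  also have "\<dots> = B" using B' assms by simp
  finally show "B' = B" .
qed

lemma invertible_matI:
  assumes "A \<in> carrier_mat n n" "B \<in> carrier_mat n n" "A * B = 1\<^sub>m n" "B * A = 1\<^sub>m n"
  shows "invertible_mat A"
  using assms by (auto simp: invertible_mat_def inverts_mat_def)

text \<open>The witness of \<open>invertible_mat\<close> comes without a carrier; its dimensions are
  read off from the two identities.\<close>

lemma mat_inv_props:
  assumes A: "A \<in> carrier_mat n n" and "invertible_mat A"
  shows "mat_inv A \<in> carrier_mat n n" "A * mat_inv A = 1\<^sub>m n" "mat_inv A * A = 1\<^sub>m n"
proof -
  from assms obtain B where B: "A * B = 1\<^sub>m n" "B * A = 1\<^sub>m (dim_row B)"
    by (auto simp: invertible_mat_def inverts_mat_def)
  have "dim_col B = n" using arg_cong[OF B(1), of dim_col] by simp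
  moreover have "dim_row B = n" using arg_cong[OF B(2), of dim_col] A by simp
  ultimately have Bc: "B \<in> carrier_mat n n" by auto
  have "mat_inv A = B" using B Bc A by (intro mat_inv_eqI) auto
  then show "mat_inv A \<in> carrier_mat n n" "A * mat_inv A = 1\<^sub>m n" "mat_inv A * A = 1\<^sub>m n"
    using B Bc by auto
qed

text \<open>A trivial kernel gives a nonzero determinant, and then \<open>A\<close> is a unit of the
  matrix ring.\<close>

lemma injective_imp_inverse:
  fixes A :: "complex mat"
  assumes A: "A \<in> carrier_mat n n"
    and inj: "\<And>v. v \<in> carrier_vec n \<Longrightarrow> A *\<^sub>v v = 0\<^sub>v n \<Longrightarrow> v = 0\<^sub>v n"
  obtains B where "B \<in> carrier_mat n n" "A * B = 1\<^sub>m n" "B * A = 1\<^sub>m n"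
proof -
  have "det A \<noteq> 0" using det_0_iff_vec_prod_zero[OF A] inj by blast
  from det_non_zero_imp_unit[OF A this, of "()"] 
  show thesis using that by (auto simp: Units_def ring_mat_def)
qed


section \<open>Free polynomials and the sets they define\<close>

lemma fpeval_carrier:
  assumes "x \<in> Md d"
  shows "fpeval p x \<in> carrier_mat (fst x) (fst x)"
proof -
  obtain n X where x: "x = (n, X)" by force
  show ?thesis
    using assms unfolding x by (induction p) (auto simp: Md_def)
qed

lemma fpeval_dim [simp]:
  assumes "x \<in> Md d"
  shows "dim_row (fpeval p x) = fst x" "dim_col (fpeval p x) = fst x"
  using fpeval_carrier[OF assms, of p] by auto

lemma Md_size_pos: "x \<in> Md d \<Longrightarrow> 0 < fst x"
  by (auto simp: Md_def)

lemma fpeval_FConst: "fpeval (FConst c) x = c \<cdot>\<^sub>m 1\<^sub>m (fst x)"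
  by (cases x) simp

lemma fpeval_scale:
  assumes "x \<in> Md d"
  shows "fpeval (FMul (FConst c) p) x = c \<cdot>\<^sub>m fpeval p x"
  using fpeval_carrier[OF assms, of p]
  by (simp add: fpeval_FConst mult_smult_assoc_mat[of _ "fst x" "fst x" _ "fst x"])

text \<open>Linear combinations stay polynomials rather than matrices, so that coefficients found at
  one point can be used at every other point.\<close>

fun fp_lincomb :: "(nat \<Rightarrow> complex) \<Rightarrow> (nat \<Rightarrow> fpoly) \<Rightarrow> nat \<Rightarrow> fpoly" where
  "fp_lincomb c w 0 = FConst 0"
| "fp_lincomb c w (Suc k) = FAdd (fp_lincomb c w k) (FMul (FConst (c k)) (w k))"

lemma fpeval_lincomb_index:
  assumes "x \<in> Md d" "i < fst x" "j < fst x"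
  shows "fpeval (fp_lincomb c w k) x $$ (i, j) = (\<Sum>l<k. c l * fpeval (w l) x $$ (i, j))"
proof (induction k)
  case 0
  then show ?case using assms by (simp add: fpeval_FConst)
next
  case (Suc k)
  have "fpeval (fp_lincomb c w (Suc k)) x = fpeval (fp_lincomb c w k) x + c k \<cdot>\<^sub>m fpeval (w k) x"
    using fpeval_scale[OF assms(1)] by simp
  then show ?case using Suc assms by simp
qed

lemma fpeval_lincomb_mult_vec:
  assumes "x \<in> Md d" "v \<in> carrier_vec (fst x)" "i < fst x"
  shows "(fpeval (fp_lincomb c w k) x *\<^sub>v v) $ i = (\<Sum>l<k. c l * (fpeval (w l) x *\<^sub>v v) $ i)"
proof -
  have "(fpeval (fp_lincomb c w k) x *\<^sub>v v) $ i
      = (\<Sum>j<fst x. \<Sum>l<k. c l * fpeval (w l) x $$ (i, j) * v $ j)"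
    using assms by (simp add: scalar_prod_def fpeval_lincomb_index lessThan_atLeast0 sum_distrib_right)
  also have "\<dots> = (\<Sum>l<k. \<Sum>j<fst x. c l * fpeval (w l) x $$ (i, j) * v $ j)"
    by (rule sum.swap)
  also have "\<dots> = (\<Sum>l<k. c l * (fpeval (w l) x *\<^sub>v v) $ i)"
    using assms by (simp add: scalar_prod_def lessThan_atLeast0 sum_distrib_left mult.assoc)
  finally show ?thesis .
qed

section \<open>The action of a polynomial matrix in block coordinates\<close>

definition block_apply :: "fpoly mat \<Rightarrow> point \<Rightarrow> (nat \<Rightarrow> nat \<Rightarrow> complex) \<Rightarrow> nat \<Rightarrow> nat \<Rightarrow> complex" where
  "block_apply \<delta> x u a i = (\<Sum>b<dim_col \<delta>. \<Sum>j<fst x. fpeval (\<delta> $$ (a, b)) x $$ (i, j) * u b j)"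

definition block_norm :: "nat \<Rightarrow> nat \<Rightarrow> (nat \<Rightarrow> nat \<Rightarrow> complex) \<Rightarrow> real" where
  "block_norm J n u = L2_set (\<lambda>(a, i). cmod (u a i)) ({..<J} \<times> {..<n})"

text \<open>Vectors are families \<open>u b j\<close>, block index first, instead of flat vectors.
  This keeps \<open>div\<close> and \<open>mod\<close> out of the later estimates and makes it easy
  to split either index range.\<close>

definition block_bound :: "fpoly mat \<Rightarrow> point \<Rightarrow> real \<Rightarrow> bool" where
  "block_bound \<delta> x C \<longleftrightarrow> 0 \<le> C \<and>
     (\<forall>u. block_norm (dim_row \<delta>) (fst x) (block_apply \<delta> x u) \<le> C * block_norm (dim_col \<delta>) (fst x) u)"

lemma block_norm_nonneg [simp]: "0 \<le> block_norm J n u"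
  by (simp add: block_norm_def)

lemma block_norm_sq: "(block_norm J n u)\<^sup>2 = (\<Sum>a<J. \<Sum>i<n. (cmod (u a i))\<^sup>2)"
proof -
  have "(block_norm J n u)\<^sup>2 = (\<Sum>(a, i)\<in>{..<J} \<times> {..<n}. (cmod (u a i))\<^sup>2)"
    unfolding block_norm_def L2_set_def
    by (subst real_sqrt_pow2) (auto intro!: sum_nonneg sum.cong)
  then show ?thesis by (simp add: sum.cartesian_product)
qed

lemma block_norm_cong:
  assumes "\<And>a i. a < J \<Longrightarrow> i < n \<Longrightarrow> u a i = u' a i"
  shows "block_norm J n u = block_norm J n u'"
  unfolding block_norm_def using assms by (intro L2_set_cong) auto

lemma block_norm_triangle:
  "block_norm J n (\<lambda>a i. u a i + u' a i) \<le> block_norm J n u + block_norm J n u'"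
  using L2_set_cmod_triangle[of "\<lambda>(a, i). u a i" "\<lambda>(a, i). u' a i" "{..<J} \<times> {..<n}"]
  by (simp add: block_norm_def case_prod_unfold)

lemma block_norm_scale: "block_norm J n (\<lambda>a i. c * u a i) = cmod c * block_norm J n u"
  by (simp add: block_norm_def L2_set_right_distrib norm_mult case_prod_unfold)

lemma block_boundD:
  "block_bound \<delta> x C \<Longrightarrow>
     block_norm (dim_row \<delta>) (fst x) (block_apply \<delta> x u) \<le> C * block_norm (dim_col \<delta>) (fst x) u"
  by (simp add: block_bound_def)

lemma block_bound_mono: "block_bound \<delta> x C \<Longrightarrow> C \<le> C' \<Longrightarrow> block_bound \<delta> x C'"
  unfolding block_bound_def by (meson mult_right_mono order_trans block_norm_nonneg)

lemma sum_lessThan_mult: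
  fixes f :: "nat \<Rightarrow> 'a :: comm_monoid_add"
  shows "(\<Sum>k<J * n. f k) = (\<Sum>a<J. \<Sum>i<n. f (a * n + i))"
proof (induction J)
  case (Suc J)
  have "(\<Sum>k<Suc J * n. f k) = (\<Sum>k<J * n + n. f k)" by (simp add: add.commute)
  then show ?case using Suc by (simp add: sum_lessThan_add)
qed simp

lemma vnorm_eq_block_norm:
  assumes "dim_vec v = J * n"
  shows "vnorm v = block_norm J n (\<lambda>a i. v $ (a * n + i))"
proof -
  have "(vnorm v)\<^sup>2 = (block_norm J n (\<lambda>a i. v $ (a * n + i)))\<^sup>2"
    by (simp add: block_norm_sq vnorm_def sum_nonneg assms sum_lessThan_mult)
  then show ?thesis by (simp add: power2_eq_iff_nonneg)
qed

lemma block_index_less: "a < J \<Longrightarrow> i < n \<Longrightarrow> a * n + i < J * (n :: nat)"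
proof -
  assume "a < J" "i < n"
  then have "a * n + i < Suc a * n" by simp
  also have "\<dots> \<le> J * n" using \<open>a < J\<close> by (intro mult_right_mono) auto
  finally show ?thesis .
qed

lemma fpmat_eval_mult_vec:
  assumes v: "v \<in> carrier_vec (dim_col \<delta> * fst x)" and a: "a < dim_row \<delta>" "i < fst x"
  shows "(fpmat_eval \<delta> x *\<^sub>v v) $ (a * fst x + i)
      = block_apply \<delta> x (\<lambda>b j. v $ (b * fst x + j)) a i"
proof -
  let ?n = "fst x"
  have row: "a * ?n + i < dim_row \<delta> * ?n" using a by (rule block_index_less)
  have "(fpmat_eval \<delta> x *\<^sub>v v) $ (a * ?n + i)
      = (\<Sum>k<dim_col \<delta> * ?n. fpmat_eval \<delta> x $$ (a * ?n + i, k) * v $ k)"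
    using row v by (simp add: fpmat_eval_def Let_def scalar_prod_def lessThan_atLeast0)
  also have "\<dots> = (\<Sum>b<dim_col \<delta>. \<Sum>j<?n. fpmat_eval \<delta> x $$ (a * ?n + i, b * ?n + j) * v $ (b * ?n + j))"
    by (rule sum_lessThan_mult)
  also have "\<dots> = block_apply \<delta> x (\<lambda>b j. v $ (b * ?n + j)) a i"
    unfolding block_apply_def
  proof (intro sum.cong refl)
    fix b j assume bj: "b \<in> {..<dim_col \<delta>}" "j \<in> {..<?n}"
    then have "b * ?n + j < dim_col \<delta> * ?n" by (intro block_index_less) auto
    then show "fpmat_eval \<delta> x $$ (a * ?n + i, b * ?n + j) * v $ (b * ?n + j)
        = fpeval (\<delta> $$ (a, b)) x $$ (i, j) * v $ (b * ?n + j)"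
      using row a bj by (simp add: fpmat_eval_def Let_def)
  qed
  finally show ?thesis .
qed

lemma block_bound_iff_op_bound: "block_bound \<delta> x C \<longleftrightarrow> op_bound (fpmat_eval \<delta> x) C"
proof -
  let ?n = "fst x"
  let ?J = "dim_row \<delta>" and ?K = "dim_col \<delta>"
  have dims: "dim_row (fpmat_eval \<delta> x) = ?J * ?n" "dim_col (fpmat_eval \<delta> x) = ?K * ?n"
    by (simp_all add: fpmat_eval_def Let_def)
  have norm1: "vnorm (fpmat_eval \<delta> x *\<^sub>v v)
        = block_norm ?J ?n (block_apply \<delta> x (\<lambda>b j. v $ (b * ?n + j)))"
    if "v \<in> carrier_vec (?K * ?n)" for v
    using that dims
    by (subst vnorm_eq_block_norm[of _ ?J ?n]) (auto intro!: block_norm_cong simp del: index_mult_mat_vec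
        simp: fpmat_eval_mult_vec)
  show ?thesis
  proof
    assume B: "block_bound \<delta> x C"
    show "op_bound (fpmat_eval \<delta> x) C"
      unfolding op_bound_def dims
    proof (intro conjI ballI)
      fix v :: "complex vec" assume v: "v \<in> carrier_vec (?K * ?n)"
      show "vnorm (fpmat_eval \<delta> x *\<^sub>v v) \<le> C * vnorm v"
        using norm1[OF v] block_boundD[OF B] vnorm_eq_block_norm[of v ?K ?n] v by simp
    qed (use B in \<open>simp add: block_bound_def\<close>)
  next
    assume B: "op_bound (fpmat_eval \<delta> x) C"
    show "block_bound \<delta> x C"
      unfolding block_bound_def
    proof (intro conjI allI)
      fix u :: "nat \<Rightarrow> nat \<Rightarrow> complex"
      \<comment> \<open>The passage back to flat vectors: quotient and remainder of the index
        recover the two indices of \<open>u\<close>.\<close>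
      define v where "v = vec (?K * ?n) (\<lambda>k. u (k div ?n) (k mod ?n))"
      have v: "v \<in> carrier_vec (?K * ?n)" by (simp add: v_def)
      have vu: "v $ (b * ?n + j) = u b j" if "b < ?K" "j < ?n" for b j
        using that block_index_less[OF that] by (simp add: v_def)
      have "block_norm ?J ?n (block_apply \<delta> x u) = vnorm (fpmat_eval \<delta> x *\<^sub>v v)"
        unfolding norm1[OF v] by (rule block_norm_cong) (simp add: block_apply_def vu)
      moreover have "block_norm ?K ?n u = vnorm v"
        using v by (subst vnorm_eq_block_norm[of _ ?K ?n]) (auto intro!: block_norm_cong simp: vu)
      ultimately show "block_norm ?J ?n (block_apply \<delta> x u) \<le> C * block_norm ?K ?n u"
        using op_boundD[OF B] v dims by simp
    qed (use B in \<open>simp add: op_bound_def\<close>)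
  qed
qed

lemma mem_G_iff: "x \<in> G d \<delta> \<longleftrightarrow> x \<in> Md d \<and> (\<exists>C<1. block_bound \<delta> x C)"
proof -
  have "opnorm (fpmat_eval \<delta> x) < 1 \<longleftrightarrow> (\<exists>C<1. op_bound (fpmat_eval \<delta> x) C)"
    using op_bound_opnorm op_bound_imp_opnorm_le by (meson order_le_less_trans)
  then show ?thesis by (simp add: G_def block_bound_iff_op_bound)
qed

lemma G_subset_Md: "G d \<delta> \<subseteq> Md d"
  by (auto simp: G_def)

section \<open>Intersections and shrinkings of basic sets\<close>

definition fpmat_dsum :: "fpoly mat \<Rightarrow> fpoly mat \<Rightarrow> fpoly mat" where
  "fpmat_dsum \<delta> \<epsilon> = mat (dim_row \<delta> + dim_row \<epsilon>) (dim_col \<delta> + dim_col \<epsilon>)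
     (\<lambda>(a, b). if a < dim_row \<delta> then (if b < dim_col \<delta> then \<delta> $$ (a, b) else FConst 0)
               else (if b < dim_col \<delta> then FConst 0 else \<epsilon> $$ (a - dim_row \<delta>, b - dim_col \<delta>)))"

lemma block_norm_add_sq:
  "(block_norm (J + J') n u)\<^sup>2 = (block_norm J n u)\<^sup>2 + (block_norm J' n (\<lambda>a. u (J + a)))\<^sup>2"
  by (simp add: block_norm_sq sum_lessThan_add)

lemma block_apply_fpmat_dsum:
  assumes "i < fst x"
  shows "a < dim_row \<delta> \<Longrightarrow> block_apply (fpmat_dsum \<delta> \<epsilon>) x u a i = block_apply \<delta> x u a i"
    and "a < dim_row \<epsilon> \<Longrightarrow> block_apply (fpmat_dsum \<delta> \<epsilon>) x u (dim_row \<delta> + a) i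
           = block_apply \<epsilon> x (\<lambda>b. u (dim_col \<delta> + b)) a i"
  using assms by (simp_all add: block_apply_def fpmat_dsum_def sum_lessThan_add fpeval_FConst)

text \<open>Squared norms add over the two diagonal blocks, which gives one direction. For the
  other, a vector for one block is padded by zero in the other block.\<close>

lemma block_bound_fpmat_dsum:
  "block_bound (fpmat_dsum \<delta> \<epsilon>) x C \<longleftrightarrow> block_bound \<delta> x C \<and> block_bound \<epsilon> x C"
proof -
  let ?n = "fst x"
  let ?J = "dim_row \<delta>" and ?K = "dim_col \<delta>" and ?J' = "dim_row \<epsilon>" and ?K' = "dim_col \<epsilon>"
  let ?D = "fpmat_dsum \<delta> \<epsilon>"
  have dims: "dim_row ?D = ?J + ?J'" "dim_col ?D = ?K + ?K'" by (simp_all add: fpmat_dsum_def)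
  have split: "(block_norm (?J + ?J') ?n (block_apply ?D x u))\<^sup>2
      = (block_norm ?J ?n (block_apply \<delta> x u))\<^sup>2
        + (block_norm ?J' ?n (block_apply \<epsilon> x (\<lambda>b. u (?K + b))))\<^sup>2" for u
  proof -
    have "block_norm ?J ?n (block_apply ?D x u) = block_norm ?J ?n (block_apply \<delta> x u)"
      by (rule block_norm_cong) (simp add: block_apply_fpmat_dsum)
    moreover have "block_norm ?J' ?n (\<lambda>a. block_apply ?D x u (?J + a))
        = block_norm ?J' ?n (block_apply \<epsilon> x (\<lambda>b. u (?K + b)))"
      by (rule block_norm_cong) (simp add: block_apply_fpmat_dsum)
    ultimately show ?thesis by (simp add: block_norm_add_sq)
  qed
  show ?thesis
  proof
    assume B: "block_bound \<delta> x C \<and> block_bound \<epsilon> x C"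
    then have C: "0 \<le> C" by (simp add: block_bound_def)
    have "block_norm (?J + ?J') ?n (block_apply ?D x u) \<le> C * block_norm (?K + ?K') ?n u" for u
    proof (rule power2_le_imp_le)
      have "(block_norm ?J ?n (block_apply \<delta> x u))\<^sup>2 \<le> (C * block_norm ?K ?n u)\<^sup>2"
        using B by (intro power_mono block_boundD) auto
      moreover have "(block_norm ?J' ?n (block_apply \<epsilon> x (\<lambda>b. u (?K + b))))\<^sup>2
          \<le> (C * block_norm ?K' ?n (\<lambda>b. u (?K + b)))\<^sup>2"
        using B by (intro power_mono block_boundD) auto
      ultimately show "(block_norm (?J + ?J') ?n (block_apply ?D x u))\<^sup>2
          \<le> (C * block_norm (?K + ?K') ?n u)\<^sup>2"
        unfolding split by (simp add: power_mult_distrib block_norm_add_sq distrib_left)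
    qed (simp add: C)
    then show "block_bound ?D x C" by (simp add: block_bound_def dims C)
  next
    assume B: "block_bound ?D x C"
    then have C: "0 \<le> C" by (simp add: block_bound_def)
    have le: "(block_norm ?J ?n (block_apply \<delta> x u))\<^sup>2
        + (block_norm ?J' ?n (block_apply \<epsilon> x (\<lambda>b. u (?K + b))))\<^sup>2
        \<le> C\<^sup>2 * ((block_norm ?K ?n u)\<^sup>2 + (block_norm ?K' ?n (\<lambda>b. u (?K + b)))\<^sup>2)" for u
    proof -
      have "(block_norm (?J + ?J') ?n (block_apply ?D x u))\<^sup>2 \<le> (C * block_norm (?K + ?K') ?n u)\<^sup>2"
        using block_boundD[OF B] by (intro power_mono) (auto simp: dims)
      then show ?thesis unfolding split by (simp add: power_mult_distrib block_norm_add_sq)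
    qed
    have "block_norm ?J ?n (block_apply \<delta> x u) \<le> C * block_norm ?K ?n u" for u
    proof (rule power2_le_imp_le)
      let ?u = "\<lambda>b. if b < ?K then u b else (\<lambda>_. 0)"
      have "block_norm ?K' ?n (\<lambda>b. ?u (?K + b)) = 0"
        by (simp add: block_norm_def L2_set_0')
      moreover have "block_norm ?K ?n ?u = block_norm ?K ?n u" by (rule block_norm_cong) simp
      moreover have "block_apply \<delta> x ?u = block_apply \<delta> x u"
        by (intro ext) (simp add: block_apply_def)
      ultimately show "(block_norm ?J ?n (block_apply \<delta> x u))\<^sup>2 \<le> (C * block_norm ?K ?n u)\<^sup>2"
        using le[of ?u] by (simp add: power_mult_distrib) (smt (verit) zero_le_power2)
    qed (simp add: C)
    moreover have "block_norm ?J' ?n (block_apply \<epsilon> x u) \<le> C * block_norm ?K' ?n u" for u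
    proof (rule power2_le_imp_le)
      let ?u = "\<lambda>b. if b < ?K then (\<lambda>_. 0) else u (b - ?K)"
      have "block_norm ?K ?n ?u = 0"
        by (simp add: block_norm_def L2_set_0')
      then show "(block_norm ?J' ?n (block_apply \<epsilon> x u))\<^sup>2 \<le> (C * block_norm ?K' ?n u)\<^sup>2"
        using le[of ?u] by (simp add: power_mult_distrib) (smt (verit) zero_le_power2)
    qed (simp add: C)
    ultimately show "block_bound \<delta> x C \<and> block_bound \<epsilon> x C" by (simp add: block_bound_def C)
  qed
qed

text \<open>The norm of a block diagonal matrix is the maximum of the norms of its blocks, so basic
  sets are closed under intersection.\<close>

lemma G_fpmat_dsum: "G d (fpmat_dsum \<delta> \<epsilon>) = G d \<delta> \<inter> G d \<epsilon>"
proof -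
  have "x \<in> G d (fpmat_dsum \<delta> \<epsilon>)" if "x \<in> G d \<delta>" "x \<in> G d \<epsilon>" for x
  proof -
    from that obtain C C' where C: "C < 1" "block_bound \<delta> x C" "C' < 1" "block_bound \<epsilon> x C'"
      by (auto simp: mem_G_iff)
    have "block_bound (fpmat_dsum \<delta> \<epsilon>) x (max C C')"
      unfolding block_bound_fpmat_dsum using C by (auto intro: block_bound_mono)
    then show ?thesis using that(1) C by (auto simp: mem_G_iff intro!: exI[of _ "max C C'"])
  qed
  then show ?thesis by (auto simp: mem_G_iff block_bound_fpmat_dsum)
qed

text \<open>Dividing \<delta> by a number \<rho> between its norm at \<open>M\<close> and 1 gives a
  basic set on which the norm of \<delta> stays a fixed distance below 1. This distance is the room
  in which off-diagonal blocks are added later.\<close>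

lemma G_shrink:
  assumes "M \<in> G d \<delta>"
  obtains \<epsilon> \<rho> where "\<rho> < 1" "M \<in> G d \<epsilon>" "\<And>x. x \<in> G d \<epsilon> \<Longrightarrow> block_bound \<delta> x \<rho>"
proof -
  from assms obtain C where C: "C < 1" "block_bound \<delta> M C" and M: "M \<in> Md d"
    by (auto simp: mem_G_iff)
  have C0: "0 \<le> C" using C by (simp add: block_bound_def)
  \<comment> \<open>The midpoint lies strictly between \<open>C\<close> and 1 and is positive even
    if \<open>C\<close> is 0, so one may divide by it.\<close>
  define \<rho> where "\<rho> = (1 + C) / 2"
  have \<rho>: "0 < \<rho>" "\<rho> < 1" "C < \<rho>" using C C0 by (auto simp: \<rho>_def)
  define \<epsilon> where "\<epsilon> = map_mat (FMul (FConst (complex_of_real (1 / \<rho>)))) \<delta>"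
  have dims: "dim_row \<epsilon> = dim_row \<delta>" "dim_col \<epsilon> = dim_col \<delta>" by (simp_all add: \<epsilon>_def)
  have app: "block_apply \<epsilon> x u a i = complex_of_real (1 / \<rho>) * block_apply \<delta> x u a i"
    if "x \<in> Md d" "a < dim_row \<delta>" "i < fst x" for x u a i
    using that unfolding block_apply_def sum_distrib_left dims
    by (intro sum.cong refl) (simp add: \<epsilon>_def fpeval_scale[OF that(1)] del: fpeval.simps)
  have norm: "block_norm (dim_row \<delta>) (fst x) (block_apply \<epsilon> x u)
      = block_norm (dim_row \<delta>) (fst x) (block_apply \<delta> x u) / \<rho>" if "x \<in> Md d" for x u
  proof -
    have "block_norm (dim_row \<delta>) (fst x) (block_apply \<epsilon> x u)
        = block_norm (dim_row \<delta>) (fst x) (\<lambda>a i. complex_of_real (1 / \<rho>) * block_apply \<delta> x u a i)"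
      by (rule block_norm_cong) (rule app[OF that])
    also have "\<dots> = block_norm (dim_row \<delta>) (fst x) (block_apply \<delta> x u) / \<rho>"
      unfolding block_norm_scale using \<rho> by (simp add: norm_divide)
    finally show ?thesis .
  qed
  have bd: "block_bound \<epsilon> x c \<longleftrightarrow> block_bound \<delta> x (c * \<rho>)" if "x \<in> Md d" for x c
    unfolding block_bound_def dims norm[OF that] using \<rho>
    by (auto simp: field_simps zero_le_mult_iff)
  show thesis
  proof (rule that[OF \<rho>(2)])
    have "block_bound \<epsilon> M (C / \<rho>)" using bd[OF M, of "C / \<rho>"] C \<rho> by simp
    moreover have "C / \<rho> < 1" using \<rho> by simp
    ultimately show "M \<in> G d \<epsilon>" using M by (auto simp: mem_G_iff)
  next
    fix x assume "x \<in> G d \<epsilon>"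
    then obtain c where c: "c < 1" "block_bound \<epsilon> x c" and x: "x \<in> Md d" by (auto simp: mem_G_iff)
    then have "block_bound \<delta> x (c * \<rho>)" using bd by simp
    then show "block_bound \<delta> x \<rho>" using c \<rho> by (rule_tac block_bound_mono) auto
  qed
qed

lemma opnorm_smult: "opnorm (c \<cdot>\<^sub>m A) = cmod c * opnorm A"
proof (rule antisym)
  show "opnorm (c \<cdot>\<^sub>m A) \<le> cmod c * opnorm A"
    by (intro op_bound_imp_opnorm_le op_bound_smult op_bound_opnorm)
  show "cmod c * opnorm A \<le> opnorm (c \<cdot>\<^sub>m A)"
  proof (cases "c = 0")
    case False
    have "A = inverse c \<cdot>\<^sub>m (c \<cdot>\<^sub>m A)" using False by (intro eq_matI) auto
    then have "opnorm A \<le> cmod (inverse c) * opnorm (c \<cdot>\<^sub>m A)"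
      by (metis op_bound_imp_opnorm_le op_bound_smult op_bound_opnorm)
    then show ?thesis using False by (simp add: norm_inverse norm_divide field_simps)
  qed (simp add: opnorm_nonneg)
qed

text \<open>A one by one matrix turns a single inequality on a polynomial into a basic set; the
  factor \<open>1 / \<eta>\<close> normalises the threshold to 1.\<close>

lemma G_single:
  assumes "0 < \<eta>"
  shows "G d (mat 1 1 (\<lambda>_. FMul (FConst (complex_of_real (1 / \<eta>))) q))
       = {x \<in> Md d. opnorm (fpeval q x) < \<eta>}"
proof -
  have "fpmat_eval (mat 1 1 (\<lambda>_. FMul (FConst (complex_of_real (1 / \<eta>))) q)) x
      = complex_of_real (1 / \<eta>) \<cdot>\<^sub>m fpeval q x" if "x \<in> Md d" for x
    using that fpeval_scale[OF that, of "complex_of_real (1 / \<eta>)" q]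
    by (intro eq_matI) (auto simp: fpmat_eval_def Let_def simp del: fpeval.simps)
  then show ?thesis
    using assms by (auto simp: G_def opnorm_smult norm_divide)
qed

lemma G_finite_family:
  assumes "finite S" "0 < \<eta>" "M \<in> Md d" "\<And>q. q \<in> S \<Longrightarrow> opnorm (fpeval q M) < \<eta>"
  obtains \<delta> where "M \<in> G d \<delta>" "\<And>x q. x \<in> G d \<delta> \<Longrightarrow> q \<in> S \<Longrightarrow> opnorm (fpeval q x) < \<eta>"
proof -
  have "\<exists>\<delta>. M \<in> G d \<delta> \<and> (\<forall>x\<in>G d \<delta>. \<forall>q\<in>S. opnorm (fpeval q x) < \<eta>)"
    using assms(1,4)
  proof (induction S)
    case empty
    \<comment> \<open>An empty family still calls for a basic set around \<open>M\<close>; the zero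
      polynomial gives one.\<close>
    have "fpeval (FConst 0) M = 0 \<cdot>\<^sub>m 1\<^sub>m (fst M)" by (rule fpeval_FConst)
    then have "M \<in> G d (mat 1 1 (\<lambda>_. FMul (FConst (complex_of_real (1 / 1))) (FConst 0)))"
      using assms(3) by (subst G_single) (auto simp: opnorm_smult)
    then show ?case by blast
  next
    case (insert q S)
    from insert.IH insert.prems obtain \<delta> where
      \<delta>: "M \<in> G d \<delta>" "\<forall>x\<in>G d \<delta>. \<forall>q\<in>S. opnorm (fpeval q x) < \<eta>" by auto
    let ?q = "mat 1 1 (\<lambda>_. FMul (FConst (complex_of_real (1 / \<eta>))) q)"
    show ?case
      using \<delta> insert.prems assms(2,3)
      by (intro exI[of _ "fpmat_dsum \<delta> ?q"], unfold G_fpmat_dsum G_single[OF assms(2)]) simp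
  qed
  then show thesis using that by blast
qed


section \<open>Nc functions on block upper triangular points\<close>

text \<open>This is the direct sum of \<open>A\<close> and \<open>B\<close> conjugated by the shear
  with corner \<open>L\<close>; so \<open>L\<close> is the conjugating parameter, and the corner of
  the result is \<open>A * L - L * B\<close>.\<close>

definition tri_mat :: "complex mat \<Rightarrow> complex mat \<Rightarrow> complex mat \<Rightarrow> complex mat" where
  "tri_mat A L B = four_block_mat A (A * L - L * B) (0\<^sub>m (dim_row B) (dim_col A)) B"

definition tri :: "point \<Rightarrow> complex mat \<Rightarrow> point \<Rightarrow> point" where
  "tri x L y = (fst x + fst y, map2 (\<lambda>A B. tri_mat A L B) (snd x) (snd y))"

definition shear :: "complex mat \<Rightarrow> complex mat" where
  "shear L = four_block_mat (1\<^sub>m (dim_row L)) L (0\<^sub>m (dim_col L) (dim_row L)) (1\<^sub>m (dim_col L))"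

lemma tri_mat_carrier:
  assumes "A \<in> carrier_mat n n" "B \<in> carrier_mat r r"
  shows "tri_mat A L B \<in> carrier_mat (n + r) (n + r)"
  using assms by (simp add: tri_mat_def)

lemma mat_rearrange_diff:
  fixes A B C :: "complex mat"
  assumes "A \<in> carrier_mat n m" "B \<in> carrier_mat n m" "C \<in> carrier_mat n m"
  shows "(A - B) + (B - C) = A - C"
  using assms by (intro eq_matI) auto

lemma tri_mat_add:
  assumes "A \<in> carrier_mat n n" "A' \<in> carrier_mat n n" "B \<in> carrier_mat r r" "B' \<in> carrier_mat r r"
    "L \<in> carrier_mat n r"
  shows "tri_mat A L B + tri_mat A' L B' = tri_mat (A + A') L (B + B')"
proof -
  have "(A * L - L * B) + (A' * L - L * B') = (A + A') * L - L * (B + B')"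
    unfolding add_mult_distrib_mat[OF assms(1,2,5)] mult_add_distrib_mat[OF assms(5,3,4)]
    using assms by (intro eq_matI) auto
  then show ?thesis
    unfolding tri_mat_def using assms
    by (subst add_four_block_mat[of _ n n _ r _ r]) auto
qed

text \<open>In the corner of the product the terms \<open>A * L * B'\<close> cancel, as they must
  since conjugation is multiplicative.\<close>

lemma tri_mat_mult:
  assumes "A \<in> carrier_mat n n" "A' \<in> carrier_mat n n" "B \<in> carrier_mat r r" "B' \<in> carrier_mat r r"
    "L \<in> carrier_mat n r"
  shows "tri_mat A L B * tri_mat A' L B' = tri_mat (A * A') L (B * B')"
proof -
  have 1: "A * (A' * L - L * B') = A * A' * L - A * L * B'"
    using assms by (simp add: mult_minus_distrib_mat[of A n n "A' * L" r "L * B'"]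
        assoc_mult_mat[of A n n A' n L r] assoc_mult_mat[of A n n L r B' r])
  have 2: "(A * L - L * B) * B' = A * L * B' - L * (B * B')"
    using assms by (simp add: minus_mult_distrib_mat[of "A * L" n r "L * B" B' r]
        assoc_mult_mat[of L n r B r B' r])
  have "A * (A' * L - L * B') + (A * L - L * B) * B' = A * A' * L - L * (B * B')"
    unfolding 1 2 using assms by (intro mat_rearrange_diff[of _ n r]) auto
  then show ?thesis
    unfolding tri_mat_def using assms
    by (subst mult_four_block_mat[of _ n n _ r _ r _ _ n _ r]) auto
qed

lemma tri_mat_scalar:
  assumes "L \<in> carrier_mat n r"
  shows "tri_mat (c \<cdot>\<^sub>m 1\<^sub>m n) L (c \<cdot>\<^sub>m 1\<^sub>m r) = c \<cdot>\<^sub>m 1\<^sub>m (n + r)"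
proof -
  have "c \<cdot>\<^sub>m 1\<^sub>m n * L = c \<cdot>\<^sub>m L"
    using assms by (simp add: mult_smult_assoc_mat[of _ n n _ r])
  moreover have "L * (c \<cdot>\<^sub>m 1\<^sub>m r) = c \<cdot>\<^sub>m L"
    using assms by (simp add: mult_smult_distrib[of _ n r _ r])
  ultimately show ?thesis
    unfolding tri_mat_def using assms by (intro eq_matI) auto
qed

lemma tri_mat_zero:
  assumes "L \<in> carrier_mat n r"
  shows "tri_mat (0\<^sub>m n n) L (0\<^sub>m r r) = 0\<^sub>m (n + r) (n + r)"
  using assms unfolding tri_mat_def by (intro eq_matI) auto

text \<open>The corner measures the failure of \<open>L\<close> to intertwine \<open>A\<close> and
  \<open>B\<close>; here it vanishes and the direct sum remains.\<close>

lemma tri_mat_intertwining: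
  assumes "A \<in> carrier_mat n n" "B \<in> carrier_mat r r" "L \<in> carrier_mat n r" "A * L = L * B"
  shows "tri_mat A L B = Defs.diag_mat A B"
  using assms unfolding tri_mat_def Defs.diag_mat_def by (intro cong_four_block_mat) auto

lemma tri_mat_eq_conj:
  assumes "A \<in> carrier_mat n n" "B \<in> carrier_mat r r" "L \<in> carrier_mat n r"
  shows "shear (- L) * Defs.diag_mat A B * shear L = tri_mat A L B"
proof -
  have "shear (- L) * Defs.diag_mat A B = four_block_mat A (- (L * B)) (0\<^sub>m r n) B"
    unfolding shear_def Defs.diag_mat_def using assms
    by (subst mult_four_block_mat[of _ n n _ r _ r _ _ n _ r]) auto
  moreover have "four_block_mat A (- (L * B)) (0\<^sub>m r n) B * shear L
     = four_block_mat A (A * L + - (L * B)) (0\<^sub>m r n) B"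
    unfolding shear_def using assms
    by (subst mult_four_block_mat[of _ n n _ r _ r _ _ n _ r]) auto
  moreover have "A * L + - (L * B) = A * L - L * B"
    using assms by (intro eq_matI) auto
  ultimately show ?thesis using assms by (simp add: tri_mat_def)
qed

lemma shear_mult:
  assumes "L \<in> carrier_mat n r" "L' \<in> carrier_mat n r" "L + L' = 0\<^sub>m n r"
  shows "shear L * shear L' = 1\<^sub>m (n + r)"
proof -
  have "L' + L = 0\<^sub>m n r" using assms comm_add_mat by metis
  then show ?thesis
    unfolding shear_def using assms
    by (subst mult_four_block_mat[of _ n n _ r _ r _ _ n _ r]) auto
qed

lemma shear_inverse:
  assumes "L \<in> carrier_mat n r"
  shows "shear (- L) * shear L = 1\<^sub>m (n + r)" "shear L * shear (- L) = 1\<^sub>m (n + r)"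
  using assms by (auto intro!: shear_mult)

lemma shear_carrier: "L \<in> carrier_mat n r \<Longrightarrow> shear L \<in> carrier_mat (n + r) (n + r)"
  by (auto simp: shear_def)

lemma Md_cases:
  assumes "x \<in> Md d"
  obtains n X where "x = (n, X)" "n \<ge> 1" "length X = d" "\<And>i. i < d \<Longrightarrow> X ! i \<in> carrier_mat n n"
  using assms by (cases x) (auto simp: Md_def)

lemma tri_Md:
  assumes "x \<in> Md d" "y \<in> Md d"
  shows "tri x L y \<in> Md d"
proof -
  obtain n X where x: "x = (n, X)" "n \<ge> 1" "length X = d" "\<And>i. i < d \<Longrightarrow> X ! i \<in> carrier_mat n n"
    using assms(1) by (blast elim: Md_cases)
  obtain r Y where y: "y = (r, Y)" "r \<ge> 1" "length Y = d" "\<And>i. i < d \<Longrightarrow> Y ! i \<in> carrier_mat r r"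
    using assms(2) by (blast elim: Md_cases)
  have "A \<in> carrier_mat (n + r) (n + r)" if "A \<in> set (snd (tri x L y))" for A
    using that x y by (auto simp: tri_def in_set_conv_nth intro!: tri_mat_carrier)
  then show ?thesis using x y by (simp add: Md_def tri_def)
qed

text \<open>For fixed \<open>L\<close> the map \<open>tri_mat\<close> respects sums, products and
  scalars, so induction on the polynomial works. A variable beyond the length of the tuple evaluates
  to zero and is covered by \<open>tri_mat_zero\<close>.\<close>

lemma fpeval_tri:
  assumes "x \<in> Md d" "y \<in> Md d" "L \<in> carrier_mat (fst x) (fst y)"
  shows "fpeval p (tri x L y) = tri_mat (fpeval p x) L (fpeval p y)"
proof (induction p)
  case (FVar i)
  obtain n X where x: "x = (n, X)" "n \<ge> 1" "length X = d" "\<And>i. i < d \<Longrightarrow> X ! i \<in> carrier_mat n n"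
    using assms(1) by (blast elim: Md_cases)
  obtain r Y where y: "y = (r, Y)" "r \<ge> 1" "length Y = d" "\<And>i. i < d \<Longrightarrow> Y ! i \<in> carrier_mat r r"
    using assms(2) by (blast elim: Md_cases)
  show ?case using x y assms(3) by (simp add: tri_def tri_mat_zero)
next
  case (FConst c)
  then show ?case using assms(3) by (simp add: fpeval_FConst tri_mat_scalar) (simp add: tri_def)
next
  case (FAdd p q)
  then show ?case
    using tri_mat_add[OF fpeval_carrier[OF assms(1)] fpeval_carrier[OF assms(1)]
        fpeval_carrier[OF assms(2)] fpeval_carrier[OF assms(2)] assms(3)] by simp
next
  case (FMul p q)
  then show ?case
    using tri_mat_mult[OF fpeval_carrier[OF assms(1)] fpeval_carrier[OF assms(1)]
        fpeval_carrier[OF assms(2)] fpeval_carrier[OF assms(2)] assms(3)] by simp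
qed

text \<open>Intertwining passes from the coordinates to all polynomials by moving \<open>L\<close>
  past one factor at a time. Variables with index at least \<open>d\<close> are zero at both
  points.\<close>

lemma fpeval_intertwining:
  assumes "x \<in> Md d" "y \<in> Md d" "L \<in> carrier_mat (fst x) (fst y)"
    and "\<And>i. i < d \<Longrightarrow> fpeval (FVar i) x * L = L * fpeval (FVar i) y"
  shows "fpeval p x * L = L * fpeval p y"
proof (induction p)
  case (FVar i)
  show ?case
  proof (cases "i < d")
    case False
    then show ?thesis using assms(1-3) by (elim Md_cases) simp
  qed (rule assms(4))
next
  case (FConst c)
  have "c \<cdot>\<^sub>m 1\<^sub>m (fst x) * L = c \<cdot>\<^sub>m L"
    using assms(3) by (simp add: mult_smult_assoc_mat[of _ "fst x" "fst x" _ "fst y"])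
  moreover have "L * (c \<cdot>\<^sub>m 1\<^sub>m (fst y)) = c \<cdot>\<^sub>m L"
    using assms(3) by (simp add: mult_smult_distrib[of _ "fst x" "fst y" _ "fst y"])
  ultimately show ?case by (simp add: fpeval_FConst)
next
  case (FAdd p q)
  then show ?case
    using add_mult_distrib_mat[OF fpeval_carrier[OF assms(1)] fpeval_carrier[OF assms(1)] assms(3), of p q]
      mult_add_distrib_mat[OF assms(3) fpeval_carrier[OF assms(2)] fpeval_carrier[OF assms(2)], of p q]
    by simp
next
  case (FMul p q)
  note c = fpeval_carrier[OF assms(1)] fpeval_carrier[OF assms(2)]
  have "fpeval p x * fpeval q x * L = fpeval p x * (L * fpeval q y)"
    using assoc_mult_mat[OF c(1) c(1) assms(3), of p q] FMul by simp
  also have "\<dots> = L * fpeval p y * fpeval q y"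
    using assoc_mult_mat[OF c(1) assms(3) c(2), of p q] FMul by simp
  also have "\<dots> = L * (fpeval p y * fpeval q y)"
    by (rule assoc_mult_mat[OF assms(3) c(2) c(2)])
  finally show ?case by simp
qed

lemma tri_eq_simil:
  assumes "x \<in> Md d" "y \<in> Md d" "L \<in> carrier_mat (fst x) (fst y)"
  shows "tri x L y = simil (shear (- L)) (shear L) (dsum x y)"
proof -
  obtain n X where x: "x = (n, X)" "length X = d" "\<And>i. i < d \<Longrightarrow> X ! i \<in> carrier_mat n n"
    using assms(1) by (blast elim: Md_cases)
  obtain r Y where y: "y = (r, Y)" "length Y = d" "\<And>i. i < d \<Longrightarrow> Y ! i \<in> carrier_mat r r"
    using assms(2) by (blast elim: Md_cases)
  show ?thesis
    using x y assms(3)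
    by (auto simp: tri_def simil_def dsum_def set_zip tri_mat_eq_conj[of _ n _ r])
qed

lemma tri_intertwining:
  assumes "x \<in> Md d" "y \<in> Md d" "L \<in> carrier_mat (fst x) (fst y)"
    and "\<And>i. i < d \<Longrightarrow> fpeval (FVar i) x * L = L * fpeval (FVar i) y"
  shows "tri x L y = dsum x y"
proof -
  obtain n X where x: "x = (n, X)" "length X = d" "\<And>i. i < d \<Longrightarrow> X ! i \<in> carrier_mat n n"
    using assms(1) by (blast elim: Md_cases)
  obtain r Y where y: "y = (r, Y)" "length Y = d" "\<And>i. i < d \<Longrightarrow> Y ! i \<in> carrier_mat r r"
    using assms(2) by (blast elim: Md_cases)
  show ?thesis
    using x y assms(3,4)
    by (auto simp: tri_def dsum_def set_zip intro!: tri_mat_intertwining[of _ n _ r])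
qed

lemma nc_function_carrier: "nc_function \<Omega> \<phi> \<Longrightarrow> x \<in> \<Omega> \<Longrightarrow> \<phi> x \<in> carrier_mat (fst x) (fst x)"
  by (simp add: nc_function_def)

text \<open>The triangular point is the direct sum conjugated by a shear, so the direct sum axiom
  and the similarity axiom together determine the value. Both points have to lie in \<Omega> for the
  axioms to apply.\<close>

lemma nc_function_tri:
  assumes nc: "nc_function \<Omega> \<phi>" and "\<Omega> \<subseteq> Md d" and x: "x \<in> \<Omega>" and y: "y \<in> \<Omega>"
    and d: "dsum x y \<in> \<Omega>" and t: "tri x L y \<in> \<Omega>" and L: "L \<in> carrier_mat (fst x) (fst y)"
  shows "\<phi> (tri x L y) = tri_mat (\<phi> x) L (\<phi> y)"
proof -
  have xy: "x \<in> Md d" "y \<in> Md d" using assms by auto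
  have eq: "tri x L y = simil (shear (- L)) (shear L) (dsum x y)"
    by (rule tri_eq_simil[OF xy L])
  have fst: "fst (dsum x y) = fst x + fst y" by (simp add: dsum_def)
  have "\<phi> (simil (shear (- L)) (shear L) (dsum x y)) = shear (- L) * \<phi> (dsum x y) * shear L"
  proof -
    have "shear L \<in> carrier_mat (fst (dsum x y)) (fst (dsum x y)) \<and>
        shear (- L) \<in> carrier_mat (fst (dsum x y)) (fst (dsum x y)) \<and>
        shear (- L) * shear L = 1\<^sub>m (fst (dsum x y)) \<and> shear L * shear (- L) = 1\<^sub>m (fst (dsum x y)) \<and>
        simil (shear (- L)) (shear L) (dsum x y) \<in> \<Omega>"
      using shear_inverse[OF L] shear_carrier[OF L] shear_carrier[of "- L"] L t eq fst by auto
    then show ?thesis using nc d unfolding nc_function_def by blast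
  qed
  also have "\<phi> (dsum x y) = Defs.diag_mat (\<phi> x) (\<phi> y)"
    using nc x y d by (simp add: nc_function_def)
  finally show ?thesis
    using tri_mat_eq_conj[OF nc_function_carrier[OF nc x] nc_function_carrier[OF nc y] L] eq by simp
qed

section \<open>Norm estimates at block triangular points\<close>

lemma L2_set_cmod_sum_le:
  assumes "finite S"
  shows "L2_set (\<lambda>i. cmod (\<Sum>k\<in>S. f k i)) A \<le> (\<Sum>k\<in>S. L2_set (\<lambda>i. cmod (f k i)) A)"
  using assms
proof (induction S)
  case (insert k S)
  have "L2_set (\<lambda>i. cmod (\<Sum>k\<in>insert k S. f k i)) A = L2_set (\<lambda>i. cmod (f k i + (\<Sum>k\<in>S. f k i))) A"
    using insert by simp
  also have "\<dots> \<le> L2_set (\<lambda>i. cmod (f k i)) A + L2_set (\<lambda>i. cmod (\<Sum>k\<in>S. f k i)) A"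
    by (rule L2_set_cmod_triangle)
  finally show ?case using insert by simp
qed (simp add: L2_set_def)

lemma block_norm_split_sq:
  "(block_norm J (n + r) u)\<^sup>2 = (block_norm J n u)\<^sup>2 + (block_norm J r (\<lambda>a i. u a (n + i)))\<^sup>2"
  by (simp add: block_norm_sq sum_lessThan_add sum.distrib)

lemma block_norm_le_sum:
  "block_norm J n u \<le> (\<Sum>a<J. L2_set (\<lambda>i. cmod (u a i)) {..<n})"
proof -
  have "(block_norm J n u)\<^sup>2 = (L2_set (\<lambda>a. L2_set (\<lambda>i. cmod (u a i)) {..<n}) {..<J})\<^sup>2"
    by (simp add: block_norm_sq L2_set_def sum_nonneg)
  then have "block_norm J n u = L2_set (\<lambda>a. L2_set (\<lambda>i. cmod (u a i)) {..<n}) {..<J}"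
    by (simp add: power2_eq_iff_nonneg)
  also have "\<dots> \<le> (\<Sum>a<J. L2_set (\<lambda>i. cmod (u a i)) {..<n})"
    by (rule L2_set_le_sum) simp
  finally show ?thesis .
qed

text \<open>The block diagonal part has norm at most \<rho>, because squared norms add over the two
  components. The corner is estimated column by column, with
  \<open>dim_row \<delta> * dim_col \<delta> * fst y\<close> columns over all entries of \<delta>.
  The error term therefore does not involve the size of \<open>x\<close>.\<close>

lemma block_bound_tri:
  assumes x: "x \<in> Md d" and y: "y \<in> Md d" and L: "L \<in> carrier_mat (fst x) (fst y)"
    and bx: "block_bound \<delta> x \<rho>" and bdy: "block_bound \<delta> y \<rho>" and \<eta>: "0 \<le> \<eta>"
    and off: "\<And>a b j. a < dim_row \<delta> \<Longrightarrow> b < dim_col \<delta> \<Longrightarrow> j < fst y \<Longrightarrow>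
       vnorm (col (fpeval (\<delta> $$ (a, b)) x * L - L * fpeval (\<delta> $$ (a, b)) y) j) \<le> \<eta>"
  shows "block_bound \<delta> (tri x L y) (\<rho> + real (dim_row \<delta> * dim_col \<delta> * fst y) * \<eta>)"
proof -
  let ?n = "fst x" and ?r = "fst y" and ?J = "dim_row \<delta>" and ?K = "dim_col \<delta>"
  let ?T = "tri x L y"
  define Off where "Off a b = fpeval (\<delta> $$ (a, b)) x * L - L * fpeval (\<delta> $$ (a, b)) y" for a b
  have fstT: "fst ?T = ?n + ?r" by (simp add: tri_def)
  have \<rho>: "0 \<le> \<rho>" using bx by (simp add: block_bound_def)
  have Odim: "Off a b \<in> carrier_mat ?n ?r" for a b
    unfolding Off_def by (intro minus_carrier_mat mult_carrier_mat[OF L] fpeval_carrier[OF y])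
  have "block_norm ?J (?n + ?r) (block_apply \<delta> ?T u)
      \<le> (\<rho> + real (?J * ?K * ?r) * \<eta>) * block_norm ?K (?n + ?r) u" for u
  proof -
    let ?N = "block_norm ?K (?n + ?r) u"
    let ?u = "\<lambda>b j. u b (?n + j)"
    \<comment> \<open>\<open>f\<close> is the action of the block diagonal part, and
      \<open>h\<close> below is the contribution of the corner, which reaches only the first
      \<open>?n\<close> coordinates.\<close>
    define f where "f a i = (if i < ?n then block_apply \<delta> x u a i else block_apply \<delta> y ?u a (i - ?n))" for a i
    define g where "g a i = (\<Sum>b<?K. \<Sum>j<?r. Off a b $$ (i, j) * ?u b j)" for a i
    define h where "h a i = (if i < ?n then g a i else 0)" for a i
    have ent: "fpeval p ?T $$ (i, j) = (if i < ?n then if j < ?n then fpeval p x $$ (i, j)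
          else (fpeval p x * L - L * fpeval p y) $$ (i, j - ?n)
          else if j < ?n then 0 else fpeval p y $$ (i - ?n, j - ?n))"
      if "i < ?n + ?r" "j < ?n + ?r" for p i j
      unfolding fpeval_tri[OF x y L] tri_mat_def using x y L that by auto
    have app: "block_apply \<delta> ?T u a i = f a i + h a i" if "a < ?J" "i < ?n + ?r" for a i
      using that unfolding block_apply_def fstT
      by (auto simp: ent sum_lessThan_add f_def h_def g_def block_apply_def Off_def sum.distrib
          simp del: index_minus_mat)
    have "block_norm ?J (?n + ?r) (block_apply \<delta> ?T u) = block_norm ?J (?n + ?r) (\<lambda>a i. f a i + h a i)"
      by (rule block_norm_cong) (rule app)
    also have "\<dots> \<le> block_norm ?J (?n + ?r) f + block_norm ?J (?n + ?r) h"
      by (rule block_norm_triangle)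
    also have "block_norm ?J (?n + ?r) f \<le> \<rho> * ?N"
    proof (rule power2_le_imp_le)
      have "block_norm ?J ?n f = block_norm ?J ?n (block_apply \<delta> x u)"
        by (rule block_norm_cong) (simp add: f_def)
      moreover have "block_norm ?J ?r (\<lambda>a i. f a (?n + i)) = block_norm ?J ?r (block_apply \<delta> y ?u)"
        by (rule block_norm_cong) (simp add: f_def)
      moreover have "(block_norm ?J ?n (block_apply \<delta> x u))\<^sup>2 \<le> (\<rho> * block_norm ?K ?n u)\<^sup>2"
        by (intro power_mono block_boundD bx) simp
      moreover have "(block_norm ?J ?r (block_apply \<delta> y ?u))\<^sup>2 \<le> (\<rho> * block_norm ?K ?r ?u)\<^sup>2"
        by (intro power_mono block_boundD bdy) simp
      ultimately show "(block_norm ?J (?n + ?r) f)\<^sup>2 \<le> (\<rho> * ?N)\<^sup>2"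
        by (simp add: block_norm_split_sq power_mult_distrib distrib_left)
    qed (simp add: \<rho>)
    also have "block_norm ?J (?n + ?r) h \<le> real (?J * ?K * ?r) * \<eta> * ?N"
    proof -
      have "(block_norm ?J (?n + ?r) h)\<^sup>2 = (block_norm ?J ?n g)\<^sup>2"
        unfolding block_norm_sq by (simp add: sum_lessThan_add h_def)
      then have "block_norm ?J (?n + ?r) h = block_norm ?J ?n g" by (simp add: power2_eq_iff_nonneg)
      also have "\<dots> \<le> (\<Sum>a<?J. L2_set (\<lambda>i. cmod (g a i)) {..<?n})" by (rule block_norm_le_sum)
      also have "\<dots> \<le> (\<Sum>a<?J. \<Sum>b<?K. \<Sum>j<?r. \<eta> * ?N)"
      proof (rule sum_mono)
        fix a assume a: "a \<in> {..<?J}"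
        have "L2_set (\<lambda>i. cmod (g a i)) {..<?n}
            \<le> (\<Sum>b<?K. L2_set (\<lambda>i. cmod (\<Sum>j<?r. Off a b $$ (i, j) * ?u b j)) {..<?n})"
          unfolding g_def by (rule L2_set_cmod_sum_le) simp
        also have "\<dots> \<le> (\<Sum>b<?K. \<Sum>j<?r. L2_set (\<lambda>i. cmod (Off a b $$ (i, j) * ?u b j)) {..<?n})"
          by (intro sum_mono L2_set_cmod_sum_le) simp
        also have "\<dots> \<le> (\<Sum>b<?K. \<Sum>j<?r. \<eta> * ?N)"
        proof (intro sum_mono)
          fix b j assume b: "b \<in> {..<?K}" and j: "j \<in> {..<?r}"
          \<comment> \<open>Each summand is a column of the corner times one coordinate of
            \<open>u\<close>, and a coordinate is at most the norm of the whole family.\<close>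
          have "L2_set (\<lambda>i. cmod (Off a b $$ (i, j) * ?u b j)) {..<?n} = vnorm (col (Off a b) j) * cmod (?u b j)"
            using Odim[of a b] j
            by (auto simp: vnorm_L2_set norm_mult L2_set_left_distrib intro!: L2_set_cong)
          also have "\<dots> \<le> \<eta> * ?N"
          proof (rule mult_mono)
            show "vnorm (col (Off a b) j) \<le> \<eta>" unfolding Off_def using a b j by (intro off) auto
            show "cmod (?u b j) \<le> ?N"
              unfolding block_norm_def
              using b j member_le_L2_set[of "{..<?K} \<times> {..<?n + ?r}" "(b, ?n + j)" "\<lambda>(a, i). cmod (u a i)"]
              by simp
          qed (use \<eta> in auto)
          finally show "L2_set (\<lambda>i. cmod (Off a b $$ (i, j) * ?u b j)) {..<?n} \<le> \<eta> * ?N" .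
        qed
        finally show "L2_set (\<lambda>i. cmod (g a i)) {..<?n} \<le> (\<Sum>b<?K. \<Sum>j<?r. \<eta> * ?N)" .
      qed
      finally show ?thesis by (simp add: mult.assoc)
    qed
    finally show ?thesis by (simp add: distrib_right)
  qed
  then show ?thesis using \<rho> \<eta> by (simp add: block_bound_def fstT)
qed

text \<open>The case of a zero corner: for \<open>L = 0\<close> the triangular point is the direct
  sum and the error in \<open>block_bound_tri\<close> is zero.\<close>

lemma dsum_mem_G:
  assumes "x \<in> G d \<delta>" "y \<in> G d \<delta>"
  shows "dsum x y \<in> G d \<delta>"
proof -
  from assms obtain C C' where C: "C < 1" "block_bound \<delta> x C" "C' < 1" "block_bound \<delta> y C'"
    and xy: "x \<in> Md d" "y \<in> Md d" by (auto simp: mem_G_iff)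
  let ?L = "0\<^sub>m (fst x) (fst y) :: complex mat"
  have comm: "fpeval p x * ?L = ?L * fpeval p y" for p
    using fpeval_carrier[OF xy(1), of p] fpeval_carrier[OF xy(2), of p] by simp
  have L: "?L \<in> carrier_mat (fst x) (fst y)" by simp
  have "block_bound \<delta> (tri x ?L y) (max C C' + real (dim_row \<delta> * dim_col \<delta> * fst y) * 0)"
  proof (rule block_bound_tri[OF xy L])
    fix a b j assume "j < fst y"
    then have "col (fpeval (\<delta> $$ (a, b)) x * ?L - ?L * fpeval (\<delta> $$ (a, b)) y) j = 0\<^sub>v (fst x)"
      unfolding comm using xy by (intro eq_vecI) (auto simp: scalar_prod_def)
    then show "vnorm (col (fpeval (\<delta> $$ (a, b)) x * ?L - ?L * fpeval (\<delta> $$ (a, b)) y) j) \<le> 0" by simp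
  qed (use C in \<open>auto intro: block_bound_mono\<close>)
  moreover have "tri x ?L y = dsum x y" by (rule tri_intertwining[OF xy L comm])
  ultimately show ?thesis
    using C tri_Md[OF xy, of ?L] by (auto simp: mem_G_iff intro!: exI[of _ "max C C'"])
qed

text \<open>If \<open>L\<close> intertwines \<open>x\<close> and \<open>y\<close>, the triangular
  point is the direct sum itself. Computing the value there in both ways forces the corner
  \<open>\<phi> x * L - L * \<phi> y\<close> to vanish.\<close>

lemma nc_function_intertwining:
  assumes nc: "nc_function (G d \<delta>) \<phi>" and x: "x \<in> G d \<delta>" and y: "y \<in> G d \<delta>"
    and L: "L \<in> carrier_mat (fst x) (fst y)"
    and comm: "\<And>i. i < d \<Longrightarrow> fpeval (FVar i) x * L = L * fpeval (FVar i) y"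
  shows "\<phi> x * L = L * \<phi> y"
proof -
  let ?n = "fst x" and ?r = "fst y"
  have xy: "x \<in> Md d" "y \<in> Md d" using x y by (auto simp: mem_G_iff)
  note c = nc_function_carrier[OF nc x] nc_function_carrier[OF nc y]
  have t: "tri x L y = dsum x y" by (rule tri_intertwining[OF xy L comm])
  have "tri_mat (\<phi> x) L (\<phi> y) = Defs.diag_mat (\<phi> x) (\<phi> y)"
    using nc_function_tri[OF nc G_subset_Md x y _ _ L] nc x y dsum_mem_G[OF x y] t
    by (simp add: nc_function_def)
  then have eq: "tri_mat (\<phi> x) L (\<phi> y) $$ (i, ?n + j) = Defs.diag_mat (\<phi> x) (\<phi> y) $$ (i, ?n + j)" for i j
    by simp
  show ?thesis
  proof (rule eq_matI)
    fix i j assume "i < dim_row (L * \<phi> y)" "j < dim_col (L * \<phi> y)"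
    then have "i < ?n" "j < ?r" using c L by auto
    then show "(\<phi> x * L) $$ (i, j) = (L * \<phi> y) $$ (i, j)"
      using eq[of i j] c L unfolding tri_mat_def Defs.diag_mat_def
      by (auto simp del: index_mult_mat(1))
  qed (use c L in auto)
qed


section \<open>Orthonormal bases\<close>

text \<open>Vectors are functions on an arbitrary index set, so that matrices can enter as functions
  of their pairs of indices, with the Frobenius inner product.\<close>

definition inner_on :: "'i set \<Rightarrow> ('i \<Rightarrow> complex) \<Rightarrow> ('i \<Rightarrow> complex) \<Rightarrow> complex" where
  "inner_on I f g = (\<Sum>i\<in>I. f i * cnj (g i))"

definition orthonormal_on :: "'i set \<Rightarrow> nat \<Rightarrow> (nat \<Rightarrow> 'i \<Rightarrow> complex) \<Rightarrow> bool" where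
  "orthonormal_on I r f \<longleftrightarrow> (\<forall>j<r. \<forall>k<r. inner_on I (f j) (f k) = (if j = k then 1 else 0))"

lemma cnj_inner_on: "cnj (inner_on I f g) = inner_on I g f"
  by (simp add: inner_on_def mult.commute)

lemma mult_cnj_cmod:
  "z * cnj z = complex_of_real ((cmod z)\<^sup>2)" "cnj z * z = complex_of_real ((cmod z)\<^sup>2)"
  by (simp_all only: complex_norm_square mult.commute)

lemma inner_on_self: "inner_on I f f = complex_of_real (\<Sum>i\<in>I. (cmod (f i))\<^sup>2)"
  by (simp add: inner_on_def mult_cnj_cmod)

lemma inner_on_diff_left: "inner_on I (\<lambda>i. f i - g i) h = inner_on I f h - inner_on I g h"
  by (simp add: inner_on_def left_diff_distrib sum_subtractf)

lemma inner_on_lincomb_left: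
  "inner_on I (\<lambda>i. \<Sum>j<r. c j * f j i) h = (\<Sum>j<r. c j * inner_on I (f j) h)"
proof -
  have "inner_on I (\<lambda>i. \<Sum>j<r. c j * f j i) h = (\<Sum>i\<in>I. \<Sum>j<r. c j * (f j i * cnj (h i)))"
    by (simp add: inner_on_def sum_distrib_right mult.assoc)
  also have "\<dots> = (\<Sum>j<r. \<Sum>i\<in>I. c j * (f j i * cnj (h i)))" by (rule sum.swap)
  finally show ?thesis by (simp add: inner_on_def sum_distrib_left)
qed

lemma inner_on_lincomb_right:
  "inner_on I h (\<lambda>i. \<Sum>j<r. c j * f j i) = (\<Sum>j<r. cnj (c j) * inner_on I h (f j))"
proof -
  have "inner_on I h (\<lambda>i. \<Sum>j<r. c j * f j i) = cnj (inner_on I (\<lambda>i. \<Sum>j<r. c j * f j i) h)"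
    by (rule cnj_inner_on[symmetric])
  also have "\<dots> = (\<Sum>j<r. cnj (c j) * inner_on I h (f j))"
    unfolding inner_on_lincomb_left by (simp add: cnj_inner_on)
  finally show ?thesis .
qed

lemma orthonormal_on_lincomb_inner:
  assumes "orthonormal_on I r f" "k < r"
  shows "inner_on I (\<lambda>i. \<Sum>j<r. c j * f j i) (f k) = c k"
proof -
  have "(\<Sum>j<r. c j * inner_on I (f j) (f k)) = (\<Sum>j<r. if j = k then c j else 0)"
    using assms by (intro sum.cong) (auto simp: orthonormal_on_def)
  then show ?thesis using assms by (simp add: inner_on_lincomb_left)
qed

lemma orthonormal_on_Parseval:
  assumes "orthonormal_on I r f"
  shows "(\<Sum>i\<in>I. (cmod (\<Sum>k<r. z k * f k i))\<^sup>2) = (\<Sum>k<r. (cmod (z k))\<^sup>2)"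
proof -
  let ?g = "\<lambda>i. \<Sum>k<r. z k * f k i"
  have "complex_of_real (\<Sum>i\<in>I. (cmod (?g i))\<^sup>2) = inner_on I ?g ?g" by (simp only: inner_on_self)
  also have "\<dots> = (\<Sum>k<r. cnj (z k) * inner_on I ?g (f k))" by (rule inner_on_lincomb_right)
  also have "\<dots> = (\<Sum>k<r. cnj (z k) * z k)"
    using orthonormal_on_lincomb_inner[OF assms] by simp
  also have "\<dots> = complex_of_real (\<Sum>k<r. (cmod (z k))\<^sup>2)"
    by (simp add: mult_cnj_cmod)
  finally show ?thesis by (simp only: of_real_eq_iff)
qed

lemma orthonormal_on_residual:
  assumes "orthonormal_on I r f" "k < r"
  shows "inner_on I (\<lambda>i. g i - (\<Sum>j<r. inner_on I g (f j) * f j i)) (f k) = 0"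
  using orthonormal_on_lincomb_inner[OF assms] by (simp add: inner_on_diff_left)

text \<open>Let \<open>p\<close> be the projection of \<open>g\<close> to the span and
  \<open>h = g - p\<close>. Since \<open>h\<close> is orthogonal to \<open>p\<close>, its squared
  norm is the difference of the two sides, which is therefore nonnegative.\<close>

lemma orthonormal_on_Bessel:
  assumes f: "orthonormal_on I r f"
  shows "(\<Sum>j<r. (cmod (inner_on I g (f j)))\<^sup>2) \<le> (\<Sum>i\<in>I. (cmod (g i))\<^sup>2)"
proof -
  define c where "c j = inner_on I g (f j)" for j
  define p where "p = (\<lambda>i. \<Sum>j<r. c j * f j i)"
  define h where "h = (\<lambda>i. g i - p i)"
  have hf: "inner_on I h (f k) = 0" if "k < r" for k
    using orthonormal_on_residual[OF f that] by (simp add: h_def p_def c_def)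
  have hp: "inner_on I h p = 0"
    unfolding p_def inner_on_lincomb_right using hf by simp
  have "inner_on I h h = inner_on I g h - inner_on I p h" by (simp add: h_def inner_on_diff_left)
  also have "inner_on I p h = 0" using hp cnj_inner_on[of I h p] by simp
  also have "inner_on I g h = cnj (inner_on I h g)" by (simp add: cnj_inner_on)
  also have "inner_on I h g = inner_on I g g - inner_on I p g" by (simp add: h_def inner_on_diff_left)
  also have "inner_on I p g = (\<Sum>j<r. c j * cnj (c j))"
    unfolding p_def inner_on_lincomb_left c_def by (simp add: cnj_inner_on)
  finally have "inner_on I h h = cnj (inner_on I g g - (\<Sum>j<r. c j * cnj (c j)))" by simp
  also have "\<dots> = complex_of_real ((\<Sum>i\<in>I. (cmod (g i))\<^sup>2) - (\<Sum>j<r. (cmod (c j))\<^sup>2))"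
    by (simp add: inner_on_self mult_cnj_cmod)
  finally have "(\<Sum>i\<in>I. (cmod (h i))\<^sup>2) = (\<Sum>i\<in>I. (cmod (g i))\<^sup>2) - (\<Sum>j<r. (cmod (c j))\<^sup>2)"
    unfolding inner_on_self of_real_eq_iff .
  moreover have "0 \<le> (\<Sum>i\<in>I. (cmod (h i))\<^sup>2)" by (simp add: sum_nonneg)
  ultimately show ?thesis by (simp add: c_def)
qed

text \<open>The inequality of Bessel for the indicator of an index \<open>i\<close> bounds the sum
  of \<open>(cmod (f j i))\<^sup>2\<close> over \<open>j\<close> by 1. Summing over \<open>i\<close>
  and exchanging the sums gives \<open>r\<close> on one side and \<open>card I\<close> on the
  other.\<close>

lemma orthonormal_on_card:
  assumes I: "finite I" and f: "orthonormal_on I r f"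
  shows "r \<le> card I"
proof -
  have le: "(\<Sum>j<r. (cmod (f j i))\<^sup>2) \<le> 1" if i: "i \<in> I" for i
  proof -
    let ?g = "\<lambda>k. if k = i then 1 else 0 :: complex"
    have "inner_on I ?g (f j) = cnj (f j i)" for j
      using I i by (simp add: inner_on_def if_distrib[of "\<lambda>x. x * _"] cong: if_cong)
    moreover have "(\<Sum>k\<in>I. (cmod (?g k))\<^sup>2) = 1"
      using I i by (simp add: if_distrib[of "\<lambda>x. (cmod x)\<^sup>2"] cong: if_cong)
    ultimately show ?thesis using orthonormal_on_Bessel[OF f, of ?g] by simp
  qed
  have one: "(\<Sum>i\<in>I. (cmod (f j i))\<^sup>2) = 1" if "j < r" for j
  proof -
    have "inner_on I (f j) (f j) = 1" using f that by (simp add: orthonormal_on_def)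
    then show ?thesis unfolding inner_on_self by (metis of_real_eq_1_iff)
  qed
  have "real r = (\<Sum>j<r. \<Sum>i\<in>I. (cmod (f j i))\<^sup>2)" using one by simp
  also have "\<dots> = (\<Sum>i\<in>I. \<Sum>j<r. (cmod (f j i))\<^sup>2)" by (rule sum.swap)
  also have "\<dots> \<le> (\<Sum>i\<in>I. 1)" by (intro sum_mono le)
  finally show ?thesis by simp
qed

text \<open>A maximal orthonormal family of values of \<open>ev\<close> spans them all, for
  otherwise a normalised residual would enlarge it. The basis is recorded by preimages
  \<open>w j\<close>; in the application these are polynomials, which can be evaluated at other
  points as well.\<close>

lemma orthonormal_basis_exists:
  fixes ev :: "'p \<Rightarrow> 'i \<Rightarrow> complex"
  assumes I: "finite I"
    and closed: "\<And>p q c. \<exists>s. \<forall>i\<in>I. ev s i = ev p i + c * ev q i"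
  obtains r w where "orthonormal_on I r (\<lambda>j. ev (w j))"
    and "\<And>p. \<exists>c. \<forall>i\<in>I. ev p i = (\<Sum>j<r. c j * ev (w j) i)"
proof -
  let ?P = "\<lambda>r. \<exists>w. orthonormal_on I r (\<lambda>j. ev (w j))"
  \<comment> \<open>The empty family is orthonormal and \<open>orthonormal_on_card\<close> bounds
    the length, so a greatest length exists.\<close>
  have "\<exists>r. ?P r \<and> (\<forall>k. ?P k \<longrightarrow> k \<le> r)"
    by (rule ex_has_greatest_nat[of ?P 0 "\<lambda>r. r" "Suc (card I)", simplified])
      (auto simp: orthonormal_on_def[of _ 0] less_Suc_eq_le orthonormal_on_card[OF I])
  then obtain r w where w: "orthonormal_on I r (\<lambda>j. ev (w j))"
    and max: "\<And>k w. orthonormal_on I k (\<lambda>j. ev (w j)) \<Longrightarrow> k \<le> r" by blast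
  have "\<exists>c. \<forall>i\<in>I. ev p i = (\<Sum>j<r. c j * ev (w j) i)" for p
  proof (rule ccontr)
    assume notin: "\<nexists>c. \<forall>i\<in>I. ev p i = (\<Sum>j<r. c j * ev (w j) i)"
    define c where "c j = inner_on I (ev p) (ev (w j))" for j
    define h where "h = (\<lambda>i. ev p i - (\<Sum>j<r. c j * ev (w j) i))"
    have "\<exists>s. \<forall>i\<in>I. ev s i = ev p i - (\<Sum>j<k. c j * ev (w j) i)" for k
    proof (induction k)
      case (Suc k)
      then obtain s where s: "\<forall>i\<in>I. ev s i = ev p i - (\<Sum>j<k. c j * ev (w j) i)" by blast
      obtain s' where "\<forall>i\<in>I. ev s' i = ev s i + (- c k) * ev (w k) i" using closed by blast
      then show ?case using s by (intro exI[of _ s']) simp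
    qed auto
    then obtain s where s: "\<And>i. i \<in> I \<Longrightarrow> ev s i = h i" unfolding h_def by blast
    define N where "N = (\<Sum>i\<in>I. (cmod (h i))\<^sup>2)"
    have "N \<noteq> 0"
    proof
      assume "N = 0"
      then have "\<forall>i\<in>I. h i = 0" using I by (simp add: N_def sum_nonneg_eq_0_iff)
      then show False using notin by (auto simp: h_def)
    qed
    then have N: "N > 0" using sum_nonneg[of I "\<lambda>i. (cmod (h i))\<^sup>2"] by (simp add: N_def order_less_le)
    define t where "t = complex_of_real (1 / sqrt N)"
    \<comment> \<open>Scaling by \<open>t\<close> is obtained from \<open>closed\<close> by adding
      \<open>t - 1\<close> times the element to itself.\<close>
    obtain s' where s': "\<forall>i\<in>I. ev s' i = ev s i + (t - 1) * ev s i" using closed by blast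
    have ev: "ev s' i = t * h i" if "i \<in> I" for i
      using s' s[OF that] that by (simp add: algebra_simps)
    define w' where "w' = w(r := s')"
    have h1: "inner_on I (ev s') (ev (w k)) = 0" if "k < r" for k
    proof -
      have "inner_on I (ev s') (ev (w k)) = t * inner_on I h (ev (w k))"
        by (simp add: inner_on_def ev sum_distrib_left mult.assoc)
      then show ?thesis using orthonormal_on_residual[OF w that, of "ev p"] by (simp add: h_def c_def)
    qed
    have h2: "inner_on I (ev (w k)) (ev s') = 0" if "k < r" for k
      using h1[OF that] by (metis cnj_inner_on complex_cnj_zero)
    have h3: "inner_on I (ev s') (ev s') = 1"
    proof -
      have "inner_on I (ev s') (ev s') = t * t * inner_on I h h"
        by (simp add: inner_on_def ev sum_distrib_left mult.assoc mult.left_commute t_def sum_divide_distrib)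
      also have "\<dots> = complex_of_real ((1 / sqrt N) * (1 / sqrt N) * N)"
        unfolding inner_on_self N_def[symmetric] t_def by (simp only: of_real_mult)
      also have "(1 / sqrt N) * (1 / sqrt N) * N = 1" using N by (simp add: field_simps)
      also have "complex_of_real 1 = 1" by simp
      finally show ?thesis .
    qed
    have "orthonormal_on I (Suc r) (\<lambda>j. ev (w' j))"
      using w h1 h2 h3 by (auto simp: orthonormal_on_def w'_def less_Suc_eq)
    from max[OF this] show False by simp
  qed
  with w show thesis using that by blast
qed

section \<open>The regular representation of the algebra generated by a point\<close>

text \<open>\<open>N\<close> is left multiplication by \<open>M\<close> on the algebra of
  polynomials in \<open>M\<close>, in coordinates of an orthonormal basis given by the
  \<open>w j\<close>. The matrix \<open>V k\<close> sends a coordinate vector to column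
  \<open>k\<close> of the algebra element it represents. Left multiplication acts on each column
  separately, so every \<open>V k\<close> intertwines, and by Parseval all columns together form an
  isometry. The vector \<open>c\<close> holds the coordinates of the identity.\<close>

lemma regular_representation:
  assumes M: "M \<in> Md d"
  obtains w N c V where
    "N \<in> Md d"
    "\<And>k. V k \<in> carrier_mat (fst M) (fst N)"
    "\<And>k i j. k < fst M \<Longrightarrow> i < fst M \<Longrightarrow> j < fst N \<Longrightarrow> V k $$ (i, j) = fpeval (w j) M $$ (i, k)"
    "\<And>k p. k < fst M \<Longrightarrow> fpeval p M * V k = V k * fpeval p N"
    "\<And>z. (\<Sum>k<fst M. \<Sum>i<fst M. (cmod (\<Sum>j<fst N. V k $$ (i, j) * z j))\<^sup>2) = (\<Sum>j<fst N. (cmod (z j))\<^sup>2)"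
    "fpeval (fp_lincomb c w (fst N)) M = 1\<^sub>m (fst M)"
proof -
  let ?m = "fst M"
  let ?I = "{..<?m} \<times> {..<?m}"
  \<comment> \<open>The column index \<open>k\<close> comes first, so that sums over
    \<open>?I\<close> match the double sum over \<open>k\<close> and \<open>i\<close> in the
    isometry.\<close>
  let ?ev = "\<lambda>p. \<lambda>(k, i). fpeval p M $$ (i, k)"
  have closed: "\<exists>s. \<forall>i\<in>?I. ?ev s i = ?ev p i + c * ?ev q i" for p q c
    using fpeval_carrier[OF M, of p] fpeval_carrier[OF M, of q] M
    by (intro exI[of _ "FAdd p (FMul (FConst c) q)"])
      (auto simp: fpeval_scale[OF M, unfolded fpeval.simps])
  obtain r w where on: "orthonormal_on ?I r (\<lambda>j. ?ev (w j))"
    and span: "\<And>p. \<exists>c. \<forall>i\<in>?I. ?ev p i = (\<Sum>j<r. c j * ?ev (w j) i)"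
    using orthonormal_basis_exists[of ?I ?ev, OF _ closed] by blast
  have "\<exists>C. \<forall>p i k. i < ?m \<longrightarrow> k < ?m \<longrightarrow> fpeval p M $$ (i, k) = (\<Sum>j<r. C p j * fpeval (w j) M $$ (i, k))"
  proof (rule choice, rule allI)
    fix p
    obtain c where "\<forall>i\<in>?I. ?ev p i = (\<Sum>j<r. c j * ?ev (w j) i)" using span by blast
    then show "\<exists>c. \<forall>i k. i < ?m \<longrightarrow> k < ?m \<longrightarrow> fpeval p M $$ (i, k) = (\<Sum>j<r. c j * fpeval (w j) M $$ (i, k))"
      by (intro exI[of _ c]) auto
  qed
  then obtain C where C: "\<And>p i k. i < ?m \<Longrightarrow> k < ?m \<Longrightarrow>
      fpeval p M $$ (i, k) = (\<Sum>j<r. C p j * fpeval (w j) M $$ (i, k))" by blast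
  define N :: point where "N = (r, map (\<lambda>l. mat r r (\<lambda>(k, j). C (FMul (FVar l) (w j)) k)) [0..<d])"
  have fstN: "fst N = r" by (simp add: N_def)
  define V where "V k = mat ?m r (\<lambda>(i, j). fpeval (w j) M $$ (i, k))" for k
  have m: "0 < ?m" using Md_size_pos[OF M] .
  \<comment> \<open>A point must have positive size; an empty basis would make the constant 1 vanish
    at \<open>M\<close>.\<close>
  have r: "r \<ge> 1"
  proof (rule ccontr)
    assume "\<not> r \<ge> 1"
    then have "r = 0" by simp
    then have "fpeval (FConst 1) M $$ (0, 0) = 0" using C[OF m m, of "FConst 1"] by simp
    then show False using m by (simp add: fpeval_FConst)
  qed
  have N: "N \<in> Md d" using r by (auto simp: N_def Md_def)
  have V: "V k \<in> carrier_mat ?m (fst N)" for k by (simp add: V_def fstN)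
  have gen: "fpeval (FVar l) M * V k = V k * fpeval (FVar l) N" if k: "k < ?m" and l: "l < d" for k l
  proof (rule eq_matI)
    fix i j assume "i < dim_row (V k * fpeval (FVar l) N)" "j < dim_col (V k * fpeval (FVar l) N)"
    then have i: "i < ?m" and j: "j < r" using V[of k] fpeval_carrier[OF N, of "FVar l"] fstN by auto
    have Nl: "fpeval (FVar l) N $$ (t, j) = C (FMul (FVar l) (w j)) t" if "t < r" for t
      using that l j by (simp add: N_def)
    have "(fpeval (FVar l) M * V k) $$ (i, j) = (fpeval (FVar l) M * fpeval (w j) M) $$ (i, k)"
      using i j k fpeval_carrier[OF M, of "FVar l"] fpeval_carrier[OF M, of "w j"]
      by (simp add: V_def scalar_prod_def)
    \<comment> \<open>The product is again a polynomial at \<open>M\<close>, so it expands in the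
      basis; its coefficients are the entries of \<open>N\<close> by definition.\<close>
    also have "\<dots> = (\<Sum>t<r. C (FMul (FVar l) (w j)) t * fpeval (w t) M $$ (i, k))"
      using C[OF i k, of "FMul (FVar l) (w j)"] by simp
    also have "\<dots> = (V k * fpeval (FVar l) N) $$ (i, j)"
      using i j fpeval_carrier[OF N, of "FVar l"] fstN
      by (simp add: V_def scalar_prod_def Nl lessThan_atLeast0 mult.commute)
    finally show "(fpeval (FVar l) M * V k) $$ (i, j) = (V k * fpeval (FVar l) N) $$ (i, j)" .
  qed (use V[of k] fpeval_carrier[OF M, of "FVar l"] fpeval_carrier[OF N, of "FVar l"] fstN in auto)
  show thesis
  proof (rule that[of N V w "C (FConst 1)", OF N V])
    show "V k $$ (i, j) = fpeval (w j) M $$ (i, k)" if "k < ?m" "i < ?m" "j < fst N" for k i j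
      using that by (simp add: V_def fstN)
    show "fpeval p M * V k = V k * fpeval p N" if "k < ?m" for k p
      by (rule fpeval_intertwining[OF M N V gen[OF that]])
    show "(\<Sum>k<?m. \<Sum>i<?m. (cmod (\<Sum>j<fst N. V k $$ (i, j) * z j))\<^sup>2) = (\<Sum>j<fst N. (cmod (z j))\<^sup>2)" for z
    proof -
      have "(\<Sum>k<?m. \<Sum>i<?m. (cmod (\<Sum>j<fst N. V k $$ (i, j) * z j))\<^sup>2)
          = (\<Sum>k<?m. \<Sum>i<?m. (cmod (\<Sum>j<r. z j * ?ev (w j) (k, i)))\<^sup>2)"
        by (simp add: V_def fstN mult.commute)
      also have "\<dots> = (\<Sum>x\<in>?I. (cmod (\<Sum>j<r. z j * ?ev (w j) x))\<^sup>2)"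
        unfolding sum.cartesian_product by (simp add: case_prod_unfold)
      also have "\<dots> = (\<Sum>j<fst N. (cmod (z j))\<^sup>2)"
        unfolding fstN by (rule orthonormal_on_Parseval[OF on])
      finally show ?thesis .
    qed
    show "fpeval (fp_lincomb (C (FConst 1)) w (fst N)) M = 1\<^sub>m ?m"
    proof (rule eq_matI)
      fix i k assume "i < dim_row (1\<^sub>m ?m :: complex mat)" "k < dim_col (1\<^sub>m ?m :: complex mat)"
      then have ik: "i < ?m" "k < ?m" by simp_all
      have "fpeval (fp_lincomb (C (FConst 1)) w (fst N)) M $$ (i, k) = fpeval (FConst 1) M $$ (i, k)"
        unfolding fpeval_lincomb_index[OF M ik] fstN by (rule C[OF ik, symmetric])
      then show "fpeval (fp_lincomb (C (FConst 1)) w (fst N)) M $$ (i, k) = 1\<^sub>m ?m $$ (i, k)"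
        using ik by (simp add: fpeval_FConst)
    qed (use M in auto)
  qed
qed

text \<open>Through the isometry formed by the \<open>V k\<close>, the value of \<delta> at
  \<open>N\<close> is the restriction of copies of its value at \<open>M\<close> to an invariant
  subspace, and restriction does not increase the norm.\<close>

lemma block_bound_intertwining:
  assumes M: "M \<in> Md d" and N: "N \<in> Md d"
    and V: "\<And>k. V k \<in> carrier_mat (fst M) (fst N)"
    and comm: "\<And>k p. k < l \<Longrightarrow> fpeval p M * V k = V k * fpeval p N"
    and isom: "\<And>z. (\<Sum>k<l. \<Sum>i<fst M. (cmod (\<Sum>j<fst N. V k $$ (i, j) * z j))\<^sup>2) = (\<Sum>j<fst N. (cmod (z j))\<^sup>2)"
    and bd: "block_bound \<delta> M \<rho>"
  shows "block_bound \<delta> N \<rho>"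
proof -
  let ?m = "fst M" and ?r = "fst N" and ?J = "dim_row \<delta>" and ?K = "dim_col \<delta>"
  have \<rho>: "0 \<le> \<rho>" using bd by (simp add: block_bound_def)
  have isom': "(\<Sum>k<l. (block_norm J ?m (\<lambda>a i. \<Sum>j<?r. V k $$ (i, j) * u a j))\<^sup>2) = (block_norm J ?r u)\<^sup>2" for J u
  proof -
    have "(\<Sum>k<l. (block_norm J ?m (\<lambda>a i. \<Sum>j<?r. V k $$ (i, j) * u a j))\<^sup>2)
        = (\<Sum>k<l. \<Sum>a<J. \<Sum>i<?m. (cmod (\<Sum>j<?r. V k $$ (i, j) * u a j))\<^sup>2)"
      by (simp add: block_norm_sq)
    also have "\<dots> = (\<Sum>a<J. \<Sum>k<l. \<Sum>i<?m. (cmod (\<Sum>j<?r. V k $$ (i, j) * u a j))\<^sup>2)"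
      by (rule sum.swap)
    finally show ?thesis by (simp add: isom block_norm_sq)
  qed
  have "block_norm ?J ?r (block_apply \<delta> N u) \<le> \<rho> * block_norm ?K ?r u" for u
  proof (rule power2_le_imp_le)
    \<comment> \<open>Each component of \<open>u\<close> is moved by \<open>V k\<close> into the
      space of \<open>M\<close>; \<open>app\<close> below is the intertwining relation for the whole
      matrix \<delta>.\<close>
    define U where "U k b i = (\<Sum>j<?r. V k $$ (i, j) * u b j)" for k b i
    have app: "block_apply \<delta> M (U k) a i = (\<Sum>j<?r. V k $$ (i, j) * block_apply \<delta> N u a j)"
      if k: "k < l" and i: "i < ?m" for k a i
    proof -
      have ent: "(\<Sum>s<?m. fpeval p M $$ (i, s) * V k $$ (s, j)) = (\<Sum>t<?r. V k $$ (i, t) * fpeval p N $$ (t, j))"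
        if j: "j < ?r" for p j
      proof -
        have "(fpeval p M * V k) $$ (i, j) = (V k * fpeval p N) $$ (i, j)" using comm[OF k] by simp
        then show ?thesis
          using i j V[of k] M N by (simp add: scalar_prod_def lessThan_atLeast0)
      qed
      have "(\<Sum>s<?m. fpeval p M $$ (i, s) * U k b s) = (\<Sum>t<?r. V k $$ (i, t) * (\<Sum>j<?r. fpeval p N $$ (t, j) * u b j))" for p b
      proof -
        have "(\<Sum>s<?m. fpeval p M $$ (i, s) * U k b s) = (\<Sum>s<?m. \<Sum>j<?r. fpeval p M $$ (i, s) * V k $$ (s, j) * u b j)"
          by (simp add: U_def sum_distrib_left mult.assoc)
        also have "\<dots> = (\<Sum>j<?r. (\<Sum>s<?m. fpeval p M $$ (i, s) * V k $$ (s, j)) * u b j)"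
          by (subst sum.swap) (simp add: sum_distrib_right)
        also have "\<dots> = (\<Sum>j<?r. (\<Sum>t<?r. V k $$ (i, t) * fpeval p N $$ (t, j)) * u b j)"
          by (simp add: ent)
        also have "\<dots> = (\<Sum>t<?r. \<Sum>j<?r. V k $$ (i, t) * fpeval p N $$ (t, j) * u b j)"
          by (subst sum.swap) (simp add: sum_distrib_right)
        finally show ?thesis by (simp add: sum_distrib_left mult.assoc)
      qed
      then have "block_apply \<delta> M (U k) a i
          = (\<Sum>b<?K. \<Sum>t<?r. V k $$ (i, t) * (\<Sum>j<?r. fpeval (\<delta> $$ (a, b)) N $$ (t, j) * u b j))"
        by (simp add: block_apply_def)
      also have "\<dots> = (\<Sum>t<?r. V k $$ (i, t) * block_apply \<delta> N u a t)"
        by (subst sum.swap) (simp add: block_apply_def sum_distrib_left)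
      finally show ?thesis .
    qed
    have "(block_norm ?J ?r (block_apply \<delta> N u))\<^sup>2
        = (\<Sum>k<l. (block_norm ?J ?m (\<lambda>a i. \<Sum>j<?r. V k $$ (i, j) * block_apply \<delta> N u a j))\<^sup>2)"
      by (rule isom'[symmetric])
    also have "\<dots> = (\<Sum>k<l. (block_norm ?J ?m (block_apply \<delta> M (U k)))\<^sup>2)"
      by (intro sum.cong refl arg_cong[where f = "\<lambda>x. x\<^sup>2"] block_norm_cong) (simp add: app)
    also have "\<dots> \<le> (\<Sum>k<l. (\<rho> * block_norm ?K ?m (U k))\<^sup>2)"
      by (intro sum_mono power_mono block_boundD[OF bd]) simp
    also have "\<dots> = \<rho>\<^sup>2 * (\<Sum>k<l. (block_norm ?K ?m (U k))\<^sup>2)"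
      by (simp add: power_mult_distrib sum_distrib_left)
    also have "(\<Sum>k<l. (block_norm ?K ?m (U k))\<^sup>2) = (block_norm ?K ?r u)\<^sup>2"
      unfolding U_def by (rule isom')
    finally show "(block_norm ?J ?r (block_apply \<delta> N u))\<^sup>2 \<le> (\<rho> * block_norm ?K ?r u)\<^sup>2"
      by (simp add: power_mult_distrib)
  qed (simp add: \<rho>)
  then show ?thesis by (simp add: block_bound_def \<rho>)
qed


section \<open>Inversion\<close>

lemma op_boundI_unit:
  assumes "0 \<le> C" "\<And>v. v \<in> carrier_vec (dim_col A) \<Longrightarrow> vnorm v \<le> 1 \<Longrightarrow> vnorm (A *\<^sub>v v) \<le> C"
  shows "op_bound A C"
proof -
  have "opnorm A \<le> C"
    unfolding opnorm_def
  proof (rule cSup_least)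
    have "vnorm (0\<^sub>v (dim_col A)) \<le> 1" by simp
    then show "{vnorm (A *\<^sub>v v) |v. v \<in> carrier_vec (dim_col A) \<and> vnorm v \<le> 1} \<noteq> {}"
      using zero_carrier_vec by blast
  qed (use assms in auto)
  then show ?thesis using opnorm_le_iff[OF assms(1)] by simp
qed

text \<open>The hypothesis bounds \<open>A * Q\<close> below by 1/2, so it is injective and has an
  inverse \<open>B\<close> of norm at most 2. Then \<open>Q * B\<close> is a right inverse of the
  square matrix \<open>A\<close>, hence its inverse, and its norm is at most
  \<open>2 * R\<close>.\<close>

lemma approx_right_inverse:
  assumes A: "A \<in> carrier_mat n n" and Q: "Q \<in> carrier_mat n n"
    and AQ: "op_bound (A * Q - 1\<^sub>m n) (1 / 2)" and R: "op_bound Q R"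
  shows "invertible_mat A" "op_bound (mat_inv A) (2 * R)"
proof -
  let ?P = "A * Q"
  have P: "?P \<in> carrier_mat n n" using A Q by simp
  have lower: "vnorm v \<le> 2 * vnorm (?P *\<^sub>v v)" if v: "v \<in> carrier_vec n" for v
  proof -
    have "(?P - 1\<^sub>m n) *\<^sub>v v = ?P *\<^sub>v v - v"
      using minus_mult_distrib_mat_vec[OF P one_carrier_mat v] v by simp
    then have "vnorm (?P *\<^sub>v v - v) \<le> 1 / 2 * vnorm v"
      using op_boundD[OF AQ, of v] v by simp
    moreover have "vnorm v \<le> vnorm (?P *\<^sub>v v) + vnorm (- 1 \<cdot>\<^sub>v (?P *\<^sub>v v - v))"
    proof -
      have "v = ?P *\<^sub>v v + - 1 \<cdot>\<^sub>v (?P *\<^sub>v v - v)"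
        using v mult_mat_vec_carrier[OF P v] by (intro eq_vecI) auto
      then show ?thesis
        using vnorm_triangle[of "?P *\<^sub>v v" n "- 1 \<cdot>\<^sub>v (?P *\<^sub>v v - v)"] mult_mat_vec_carrier[OF P v] v
        by auto
    qed
    ultimately show ?thesis by simp
  qed
  obtain B where B: "B \<in> carrier_mat n n" "?P * B = 1\<^sub>m n"
  proof (rule injective_imp_inverse[OF P])
    fix v assume v: "v \<in> carrier_vec n" "?P *\<^sub>v v = 0\<^sub>v n"
    then have "vnorm v \<le> 0" using lower[OF v(1)] by simp
    then show "v = 0\<^sub>v n" using vnorm_eq_0_iff[OF v(1)] vnorm_nonneg[of v] by simp
  qed blast
  have QB: "Q * B \<in> carrier_mat n n" using Q B by simp
  have 1: "A * (Q * B) = 1\<^sub>m n" using assoc_mult_mat[OF A Q B(1)] B(2) by simp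
  have 2: "Q * B * A = 1\<^sub>m n" by (rule mat_mult_left_right_inverse[OF A QB 1])
  show "invertible_mat A" by (rule invertible_matI[OF A QB 1 2])
  have "op_bound B 2"
    unfolding op_bound_def
  proof (intro conjI ballI)
    fix y :: "complex vec" assume "y \<in> carrier_vec (dim_col B)"
    then have y: "y \<in> carrier_vec n" using B by auto
    have "?P *\<^sub>v (B *\<^sub>v y) = y" using assoc_mult_mat_vec[OF P B(1) y] B(2) y by simp
    then show "vnorm (B *\<^sub>v y) \<le> 2 * vnorm y"
      using lower[OF mult_mat_vec_carrier[OF B(1) y]] by simp
  qed simp
  then have "op_bound (Q * B) (R * 2)" by (rule op_bound_mult[OF Q B(1) R])
  then show "op_bound (mat_inv A) (2 * R)"
    unfolding mat_inv_eqI[OF A QB 1 2] by (simp add: mult.commute)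
qed

text \<open>Apply the block matrix to a vector supported in the second component: the first
  component of the image is the corner applied to \<open>u\<close>, and dropping the other component
  does not increase the norm.\<close>

lemma tri_mat_corner_bound:
  assumes A: "A \<in> carrier_mat n n" and B: "B \<in> carrier_mat r r" and L: "L \<in> carrier_mat n r"
    and bd: "op_bound (tri_mat A L B) C" and u: "u \<in> carrier_vec r"
  shows "vnorm (A *\<^sub>v (L *\<^sub>v u) - L *\<^sub>v (B *\<^sub>v u)) \<le> C * vnorm u"
proof -
  let ?D = "A * L - L * B"
  have D: "?D \<in> carrier_mat n r" using B L by (intro minus_carrier_mat) simp
  have Du: "?D *\<^sub>v u = A *\<^sub>v (L *\<^sub>v u) - L *\<^sub>v (B *\<^sub>v u)"
    using A B L u by (simp add: minus_mult_distrib_mat_vec[of _ n r] assoc_mult_mat_vec[of _ n n _ r]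
        assoc_mult_mat_vec[of _ n r _ r])
  have "tri_mat A L B *\<^sub>v (0\<^sub>v n @\<^sub>v u) = (A *\<^sub>v 0\<^sub>v n + ?D *\<^sub>v u) @\<^sub>v (0\<^sub>m r n *\<^sub>v 0\<^sub>v n + B *\<^sub>v u)"
  proof -
    have "tri_mat A L B = four_block_mat A ?D (0\<^sub>m r n) B" using A B by (simp add: tri_mat_def)
    then show ?thesis using four_block_mat_mult_vec[OF A D zero_carrier_mat B zero_carrier_vec u] by simp
  qed
  also have "A *\<^sub>v 0\<^sub>v n + ?D *\<^sub>v u = ?D *\<^sub>v u"
  proof -
    have "A *\<^sub>v 0\<^sub>v n = 0\<^sub>v n" using A by auto
    then show ?thesis using mult_mat_vec_carrier[OF D u] by simp
  qed
  finally have eq: "tri_mat A L B *\<^sub>v (0\<^sub>v n @\<^sub>v u) = (?D *\<^sub>v u) @\<^sub>v (0\<^sub>m r n *\<^sub>v 0\<^sub>v n + B *\<^sub>v u)" .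
  have "(vnorm (?D *\<^sub>v u))\<^sup>2 \<le> (vnorm (tri_mat A L B *\<^sub>v (0\<^sub>v n @\<^sub>v u)))\<^sup>2"
    unfolding eq vnorm_append_sq by simp
  then have "vnorm (?D *\<^sub>v u) \<le> vnorm (tri_mat A L B *\<^sub>v (0\<^sub>v n @\<^sub>v u))"
    by (rule power2_le_imp_le) simp
  also have "\<dots> \<le> C * vnorm (0\<^sub>v n @\<^sub>v u)"
    using tri_mat_carrier[OF A B, of L] u by (intro op_boundD[OF bd]) auto
  also have "vnorm (0\<^sub>v n @\<^sub>v u) = vnorm u"
    using vnorm_append_sq[of "0\<^sub>v n" u] by (simp add: power2_eq_iff_nonneg)
  finally show ?thesis by (simp add: Du)
qed

text \<open>This is \<open>p\<close> times \<open>w j\<close> minus the combination of the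
  \<open>w k\<close> with coefficients from column \<open>j\<close> of \<open>fpeval p N\<close>.
  For the regular representation it vanishes at \<open>M\<close>, and its size elsewhere measures
  how far the multiplication table of the algebra is from holding there.\<close>

definition module_relation :: "(nat \<Rightarrow> fpoly) \<Rightarrow> point \<Rightarrow> fpoly \<Rightarrow> nat \<Rightarrow> fpoly" where
  "module_relation w N p j =
     FAdd (FMul p (w j)) (FMul (FConst (- 1)) (fp_lincomb (\<lambda>k. fpeval p N $$ (k, j)) w (fst N)))"

text \<open>The linear map that sends basis vector \<open>j\<close> to \<open>w j\<close> at
  \<open>x\<close> applied to \<open>v\<close>. At \<open>x = M\<close>, with \<open>w\<close> and
  \<open>N\<close> from the regular representation, it intertwines \<open>M\<close> and
  \<open>N\<close>.\<close>

definition orbit_mat :: "(nat \<Rightarrow> fpoly) \<Rightarrow> nat \<Rightarrow> point \<Rightarrow> complex vec \<Rightarrow> complex mat" where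
  "orbit_mat w r x v = mat (fst x) r (\<lambda>(i, j). (fpeval (w j) x *\<^sub>v v) $ i)"

lemma orbit_mat_carrier: "orbit_mat w r x v \<in> carrier_mat (fst x) r"
  by (simp add: orbit_mat_def)

text \<open>Coordinates turn into polynomials: this is how a vector \<open>u\<close> found at
  \<open>N\<close> yields a polynomial acting at \<open>x\<close>.\<close>

lemma orbit_mat_mult_vec:
  assumes "x \<in> Md d" "v \<in> carrier_vec (fst x)" "u \<in> carrier_vec r"
  shows "orbit_mat w r x v *\<^sub>v u = fpeval (fp_lincomb (\<lambda>j. u $ j) w r) x *\<^sub>v v"
proof (rule eq_vecI)
  fix i assume "i < dim_vec (fpeval (fp_lincomb (\<lambda>j. u $ j) w r) x *\<^sub>v v)"
  then have i: "i < fst x" using assms by simp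
  have "(orbit_mat w r x v *\<^sub>v u) $ i = (\<Sum>j<r. orbit_mat w r x v $$ (i, j) * u $ j)"
    using i assms(3) orbit_mat_carrier[of w r x v] by (simp add: scalar_prod_def lessThan_atLeast0)
  also have "\<dots> = (\<Sum>j<r. u $ j * (fpeval (w j) x *\<^sub>v v) $ i)"
    using i by (simp add: orbit_mat_def mult.commute del: index_mult_mat_vec)
  finally show "(orbit_mat w r x v *\<^sub>v u) $ i = (fpeval (fp_lincomb (\<lambda>j. u $ j) w r) x *\<^sub>v v) $ i"
    unfolding fpeval_lincomb_mult_vec[OF assms(1,2) i] .
qed (use assms in \<open>simp add: orbit_mat_def\<close>)

text \<open>The failure of the orbit map to intertwine is read off column by column, so that
  smallness of finitely many polynomials at \<open>x\<close> controls it.\<close>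

lemma orbit_mat_defect:
  assumes x: "x \<in> Md d" and N: "N \<in> Md d" and v: "v \<in> carrier_vec (fst x)" and j: "j < fst N"
  shows "col (fpeval p x * orbit_mat w (fst N) x v - orbit_mat w (fst N) x v * fpeval p N) j
    = fpeval (module_relation w N p j) x *\<^sub>v v"
proof -
  let ?n = "fst x" and ?r = "fst N" and ?L = "orbit_mat w (fst N) x v"
  let ?l = "fp_lincomb (\<lambda>k. fpeval p N $$ (k, j)) w ?r"
  note c = fpeval_carrier[OF x]
  note cN = fpeval_carrier[OF N]
  have L: "?L \<in> carrier_mat ?n ?r" by (rule orbit_mat_carrier)
  have colL: "col ?L j = fpeval (w j) x *\<^sub>v v"
    using j x by (intro eq_vecI) (auto simp: orbit_mat_def)
  have "col (fpeval p x * ?L) j = fpeval p x *\<^sub>v (fpeval (w j) x *\<^sub>v v)"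
    unfolding col_mult2[OF c L j] colL ..
  moreover have "col (?L * fpeval p N) j = fpeval ?l x *\<^sub>v v"
  proof -
    have "col (?L * fpeval p N) j = ?L *\<^sub>v col (fpeval p N) j" by (rule col_mult2[OF L cN j])
    also have "\<dots> = fpeval (fp_lincomb (\<lambda>k. col (fpeval p N) j $ k) w ?r) x *\<^sub>v v"
      using N by (intro orbit_mat_mult_vec[OF x v] carrier_vecI) simp
    also have "\<dots> = fpeval ?l x *\<^sub>v v"
    proof (rule eq_vecI)
      fix i assume "i < dim_vec (fpeval ?l x *\<^sub>v v)"
      then have i: "i < fst x" using x by simp
      show "(fpeval (fp_lincomb (\<lambda>k. col (fpeval p N) j $ k) w ?r) x *\<^sub>v v) $ i = (fpeval ?l x *\<^sub>v v) $ i"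
        unfolding fpeval_lincomb_mult_vec[OF x v i] using N j by (intro sum.cong) simp_all
    qed (use x in simp)
    finally show ?thesis .
  qed
  moreover have "col (fpeval p x * ?L - ?L * fpeval p N) j = col (fpeval p x * ?L) j - col (?L * fpeval p N) j"
    using c[of p] cN[of p] L j by (intro eq_vecI) auto
  moreover have "fpeval (module_relation w N p j) x *\<^sub>v v
      = fpeval p x *\<^sub>v (fpeval (w j) x *\<^sub>v v) - fpeval ?l x *\<^sub>v v"
  proof -
    have "fpeval (module_relation w N p j) x = fpeval p x * fpeval (w j) x + - 1 \<cdot>\<^sub>m fpeval ?l x"
      using fpeval_scale[OF x, of "- 1" ?l] by (simp add: module_relation_def)
    also have "\<dots> *\<^sub>v v = fpeval p x * fpeval (w j) x *\<^sub>v v + (- 1 \<cdot>\<^sub>m fpeval ?l x) *\<^sub>v v"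
      using c[of p] c[of "w j"] c[of ?l] v by (intro add_mult_distrib_mat_vec[of _ ?n ?n]) auto
    also have "fpeval p x * fpeval (w j) x *\<^sub>v v = fpeval p x *\<^sub>v (fpeval (w j) x *\<^sub>v v)"
      by (rule assoc_mult_mat_vec[OF c c v])
    also have "(- 1 \<cdot>\<^sub>m fpeval ?l x) *\<^sub>v v = - 1 \<cdot>\<^sub>v (fpeval ?l x *\<^sub>v v)"
      using c[of ?l] v by (intro eq_vecI) auto
    finally show ?thesis using x by (auto intro!: eq_vecI)
  qed
  ultimately show ?thesis by simp
qed

text \<open>Column \<open>k\<close> of the relation at \<open>M\<close> is the difference of the
  columns \<open>j\<close> of \<open>fpeval p M * V k\<close> and \<open>V k * fpeval p N\<close>,
  which agree.\<close>

lemma module_relation_vanishes: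
  assumes M: "M \<in> Md d" and N: "N \<in> Md d" and j: "j < fst N"
    and V: "\<And>k. V k \<in> carrier_mat (fst M) (fst N)"
    and Vw: "\<And>k i j. k < fst M \<Longrightarrow> i < fst M \<Longrightarrow> j < fst N \<Longrightarrow> V k $$ (i, j) = fpeval (w j) M $$ (i, k)"
    and comm: "\<And>k. k < fst M \<Longrightarrow> fpeval p M * V k = V k * fpeval p N"
  shows "fpeval (module_relation w N p j) M = 0\<^sub>m (fst M) (fst M)"
proof (rule eq_matI)
  let ?m = "fst M" and ?r = "fst N"
  let ?l = "fp_lincomb (\<lambda>k. fpeval p N $$ (k, j)) w ?r"
  fix i k assume "i < dim_row (0\<^sub>m ?m ?m :: complex mat)" "k < dim_col (0\<^sub>m ?m ?m :: complex mat)"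
  then have ik: "i < ?m" "k < ?m" by simp_all
  note c = fpeval_carrier[OF M]
  have "fpeval (module_relation w N p j) M = fpeval p M * fpeval (w j) M + - 1 \<cdot>\<^sub>m fpeval ?l M"
    using fpeval_scale[OF M, of "- 1" ?l] by (simp add: module_relation_def)
  then have "fpeval (module_relation w N p j) M $$ (i, k)
      = (fpeval p M * fpeval (w j) M) $$ (i, k) - fpeval ?l M $$ (i, k)"
    using ik M by (simp del: index_mult_mat(1))
  also have "(fpeval p M * fpeval (w j) M) $$ (i, k) = (fpeval p M * V k) $$ (i, j)"
    using ik j M V[of k] by (simp add: scalar_prod_def Vw)
  also have "\<dots> = (V k * fpeval p N) $$ (i, j)" using comm[OF ik(2)] by simp
  also have "\<dots> = fpeval ?l M $$ (i, k)"
    using ik j N V[of k]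
    by (simp add: fpeval_lincomb_index[OF M ik] scalar_prod_def Vw lessThan_atLeast0 mult.commute)
  finally show "fpeval (module_relation w N p j) M $$ (i, k) = 0\<^sub>m ?m ?m $$ (i, k)" using ik by simp
qed (use M in simp_all)

lemma opnorm_zero: "opnorm (0\<^sub>m n m) = 0"
proof (rule antisym)
  have "0\<^sub>m n m *\<^sub>v v = 0\<^sub>v n" if "v \<in> carrier_vec m" for v :: "complex vec"
    using that by (intro eq_vecI) auto
  then have "op_bound (0\<^sub>m n m) 0" by (auto simp: op_bound_def)
  then show "opnorm (0\<^sub>m n m) \<le> 0" by (rule op_bound_imp_opnorm_le)
qed (rule opnorm_nonneg)

text \<open>If \<open>\<psi> N\<close> kills \<open>v\<close>, then \<open>\<psi> M\<close> kills
  every \<open>V k *\<^sub>v v\<close>, because \<open>V k\<close> intertwines the values of \<psi>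
  as well. Invertibility at \<open>M\<close> makes all these vectors zero, and the isometry gives
  \<open>v = 0\<close>.\<close>

lemma nc_regular_representation_invertible:
  assumes nc: "nc_function (G d \<delta>) \<psi>" and M: "M \<in> G d \<delta>" and N: "N \<in> G d \<delta>"
    and inv: "invertible_mat (\<psi> M)"
    and V: "\<And>k. V k \<in> carrier_mat (fst M) (fst N)"
    and comm: "\<And>k p. k < l \<Longrightarrow> fpeval p M * V k = V k * fpeval p N"
    and isom: "\<And>z. (\<Sum>k<l. \<Sum>i<fst M. (cmod (\<Sum>j<fst N. V k $$ (i, j) * z j))\<^sup>2) = (\<Sum>j<fst N. (cmod (z j))\<^sup>2)"
  obtains B where "B \<in> carrier_mat (fst N) (fst N)" "\<psi> N * B = 1\<^sub>m (fst N)"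
proof -
  let ?m = "fst M" and ?r = "fst N"
  note cM = nc_function_carrier[OF nc M]
  note cN = nc_function_carrier[OF nc N]
  note iM = mat_inv_props[OF cM inv]
  show thesis
  proof (rule injective_imp_inverse[OF cN])
    fix v assume v: "v \<in> carrier_vec ?r" and 0: "\<psi> N *\<^sub>v v = 0\<^sub>v ?r"
    have z: "V k *\<^sub>v v = 0\<^sub>v ?m" if k: "k < l" for k
    proof -
      have Vv: "V k *\<^sub>v v \<in> carrier_vec ?m" using V v by (rule mult_mat_vec_carrier)
      have "\<psi> M * V k = V k * \<psi> N"
        using nc_function_intertwining[OF nc M N V] comm[OF k] by blast
      then have "\<psi> M *\<^sub>v (V k *\<^sub>v v) = V k *\<^sub>v (\<psi> N *\<^sub>v v)"
        using assoc_mult_mat_vec[OF cM V v, of k] assoc_mult_mat_vec[OF V cN v, of k] by simp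
      then have "\<psi> M *\<^sub>v (V k *\<^sub>v v) = 0\<^sub>v ?m" using 0 V[of k] by auto
      moreover have "V k *\<^sub>v v = mat_inv (\<psi> M) *\<^sub>v (\<psi> M *\<^sub>v (V k *\<^sub>v v))"
        using assoc_mult_mat_vec[OF iM(1) cM Vv] iM(3) Vv by simp
      ultimately show ?thesis using iM(1) by auto
    qed
    have "(\<Sum>j<?r. V k $$ (i, j) * v $ j) = 0" if "k < l" "i < ?m" for k i
    proof -
      have "(V k *\<^sub>v v) $ i = 0" using z[OF that(1)] that(2) by simp
      then show ?thesis using V[of k] v that(2) by (simp add: scalar_prod_def lessThan_atLeast0)
    qed
    then have "(\<Sum>j<?r. (cmod (v $ j))\<^sup>2) = 0" using isom[of "\<lambda>j. v $ j"] by simp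
    then have "vnorm v = 0" using v by (simp add: vnorm_def)
    then show "v = 0\<^sub>v ?r" using vnorm_eq_0_iff[OF v] by simp
  qed (use that in blast)
qed


text \<open>Let \<open>u = \<psi>(N)\<^sup>-\<^sup>1 a\<close>, where \<open>\<Sum>\<^sub>j a\<^sub>j w\<^sub>j\<close> is \<open>1\<close> at \<open>M\<close>. If the relations of \<open>N\<close> hold up to a small
  error at \<open>x\<close>, then \<open>\<psi>(x) \<Sum>\<^sub>j u\<^sub>j w\<^sub>j(x)\<close> is close to \<open>\<Sum>\<^sub>j a\<^sub>j w\<^sub>j(x)\<close>, which is close to \<open>1\<close>.\<close>

lemma nc_function_inverse_bounded:
  assumes nc: "nc_function (G d \<delta>) \<psi>" and bdd: "bounded_on (G d \<delta>) \<psi>"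
    and M: "M \<in> G d \<delta>" and inv: "invertible_mat (\<psi> M)"
  obtains \<epsilon> R where "M \<in> G d \<epsilon>" "G d \<epsilon> \<subseteq> G d \<delta>"
    "\<And>x. x \<in> G d \<epsilon> \<Longrightarrow> invertible_mat (\<psi> x) \<and> op_bound (mat_inv (\<psi> x)) R"
proof -
  from bdd obtain C' where C': "\<And>x. x \<in> G d \<delta> \<Longrightarrow> opnorm (\<psi> x) \<le> C'" by (auto simp: bounded_on_def)
  define C where "C = max 0 C'"
  have C: "op_bound (\<psi> x) C" if "x \<in> G d \<delta>" for x
    using C'[OF that] by (intro op_bound_mono[OF op_bound_opnorm]) (simp add: C_def)
  have C0: "0 \<le> C" by (simp add: C_def)
  have MM: "M \<in> Md d" using M by (simp add: G_def)
  obtain w N a V where N: "N \<in> Md d"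
    and V: "\<And>k. V k \<in> carrier_mat (fst M) (fst N)"
    and Vw: "\<And>k i j. k < fst M \<Longrightarrow> i < fst M \<Longrightarrow> j < fst N \<Longrightarrow> V k $$ (i, j) = fpeval (w j) M $$ (i, k)"
    and comm: "\<And>k p. k < fst M \<Longrightarrow> fpeval p M * V k = V k * fpeval p N"
    and isom: "\<And>z. (\<Sum>k<fst M. \<Sum>i<fst M. (cmod (\<Sum>j<fst N. V k $$ (i, j) * z j))\<^sup>2) = (\<Sum>j<fst N. (cmod (z j))\<^sup>2)"
    and unit: "fpeval (fp_lincomb a w (fst N)) M = 1\<^sub>m (fst M)"
    by (rule regular_representation[OF MM]) (rule that)
  let ?r = "fst N" and ?J = "dim_row \<delta>" and ?K = "dim_col \<delta>"
  obtain \<epsilon>1 \<rho> where \<rho>: "\<rho> < 1" and \<epsilon>1: "M \<in> G d \<epsilon>1" "\<And>x. x \<in> G d \<epsilon>1 \<Longrightarrow> block_bound \<delta> x \<rho>"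
    using G_shrink[OF M] by blast
  have bN: "block_bound \<delta> N \<rho>"
    by (rule block_bound_intertwining[OF MM N V comm isom \<epsilon>1(2)[OF \<epsilon>1(1)]])
  have NG: "N \<in> G d \<delta>" using bN \<rho> N by (auto simp: mem_G_iff)
  obtain B where B: "B \<in> carrier_mat ?r ?r" "\<psi> N * B = 1\<^sub>m ?r"
    using nc_regular_representation_invertible[OF nc M NG inv V comm isom] by blast
  note cN = nc_function_carrier[OF nc NG]
  define av where "av = vec ?r a"
  have av: "av \<in> carrier_vec ?r" by (simp add: av_def)
  \<comment> \<open>\<open>av\<close> holds the coordinates of the identity, and \<open>u\<close>
    solves \<open>\<psi> N *\<^sub>v u = av\<close>.\<close>
  define u where "u = B *\<^sub>v av"
  have u: "u \<in> carrier_vec ?r" using B(1) av by (simp add: u_def)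
  have \<psi>u: "\<psi> N *\<^sub>v u = av"
    using assoc_mult_mat_vec[OF cN B(1) av] B(2) av by (simp add: u_def)
  \<comment> \<open>\<open>q\<close> will be the approximate right inverse of \<psi> near
    \<open>M\<close>; \<open>e\<close> is the identity at \<open>M\<close>, and \<open>g\<close>
    measures its distance from the identity elsewhere.\<close>
  define q where "q = fp_lincomb (\<lambda>j. u $ j) w ?r"
  define e where "e = fp_lincomb (\<lambda>j. av $ j) w ?r"
  define g where "g = FAdd e (FConst (- 1))"
  have eM: "fpeval e M = 1\<^sub>m (fst M)"
  proof (rule eq_matI)
    fix i k assume "i < dim_row (1\<^sub>m (fst M) :: complex mat)" "k < dim_col (1\<^sub>m (fst M) :: complex mat)"
    then have ik: "i < fst M" "k < fst M" by simp_all
    have "fpeval e M $$ (i, k) = fpeval (fp_lincomb a w ?r) M $$ (i, k)"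
      unfolding e_def fpeval_lincomb_index[OF MM ik] by (intro sum.cong) (simp_all add: av_def)
    then show "fpeval e M $$ (i, k) = 1\<^sub>m (fst M) $$ (i, k)" by (simp add: unit)
  qed (use MM in simp_all)
  have gM: "fpeval g M = 0\<^sub>m (fst M) (fst M)"
    by (intro eq_matI) (simp_all add: g_def eM fpeval_FConst)
  \<comment> \<open>With this choice \<open>C * vnorm u\<close> divided by \<open>c\<close> is at
    most 1/4; the summand 1 keeps \<open>c\<close> positive.\<close>
  define c where "c = 4 * C * vnorm u + 1"
  have c: "0 < c" using C0 by (simp add: c_def add_nonneg_pos)
  \<comment> \<open>\<kappa> counts the columns in \<open>block_bound_tri\<close>. The tolerance
    \<eta> below is chosen so that columns of size \<open>c * \<eta>\<close> cost at most half of
    the gap \<open>1 - \<rho>\<close>.\<close>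
  define \<kappa> where "\<kappa> = real (?J * ?K * ?r)"
  have \<kappa>: "0 \<le> \<kappa>" by (simp add: \<kappa>_def)
  define \<eta> where "\<eta> = (1 - \<rho>) / (2 * (\<kappa> * c + 1))"
  have \<eta>: "0 < \<eta>" using \<rho> \<kappa> c by (simp add: \<eta>_def add_nonneg_pos)
  have small: "\<rho> + \<kappa> * (c * \<eta>) < 1"
  proof -
    have "\<kappa> * (c * \<eta>) = (\<kappa> * c) / (\<kappa> * c + 1) * ((1 - \<rho>) / 2)"
      by (simp add: \<eta>_def mult.assoc mult.commute[of _ 2])
    also have "\<dots> \<le> 1 * ((1 - \<rho>) / 2)"
      using \<rho> \<kappa> c by (intro mult_right_mono) (auto simp: divide_le_eq_1 add_nonneg_pos)
    finally show ?thesis using \<rho> by (simp add: field_simps)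
  qed
  \<comment> \<open>Finitely many relations suffice: one for each entry of \<delta> and each basis
    vector.\<close>
  define S where "S = (\<lambda>(a, b, j). module_relation w N (\<delta> $$ (a, b)) j) ` ({..<?J} \<times> {..<?K} \<times> {..<?r})"
  have "finite S" by (simp add: S_def)
  moreover have "opnorm (fpeval s M) < \<eta>" if "s \<in> S" for s
  proof -
    from that have "fpeval s M = 0\<^sub>m (fst M) (fst M)"
      by (auto simp: S_def intro!: module_relation_vanishes[OF MM N _ V Vw comm])
    then show ?thesis using \<eta> by (simp add: opnorm_zero)
  qed
  ultimately obtain \<epsilon>2 where \<epsilon>2: "M \<in> G d \<epsilon>2"
    "\<And>x s. x \<in> G d \<epsilon>2 \<Longrightarrow> s \<in> S \<Longrightarrow> opnorm (fpeval s x) < \<eta>"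
    using G_finite_family[of S \<eta> M d] \<eta> MM by blast
  obtain \<epsilon>3 where \<epsilon>3: "M \<in> G d \<epsilon>3" "\<And>x s. x \<in> G d \<epsilon>3 \<Longrightarrow> s \<in> {g} \<Longrightarrow> opnorm (fpeval s x) < 1 / 4"
    using G_finite_family[of "{g}" "1 / 4" M d] MM by (auto simp: gM opnorm_zero)
  \<comment> \<open>Any number above the norm of \<open>q\<close> at \<open>M\<close> serves, since
    \<open>q\<close> stays below it on a neighbourhood.\<close>
  define R where "R = opnorm (fpeval q M) + 1"
  have R: "0 < R" using opnorm_nonneg[of "fpeval q M"] by (simp add: R_def)
  obtain \<epsilon>4 where \<epsilon>4: "M \<in> G d \<epsilon>4" "\<And>x s. x \<in> G d \<epsilon>4 \<Longrightarrow> s \<in> {q} \<Longrightarrow> opnorm (fpeval s x) < R"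
    using G_finite_family[of "{q}" R M d] MM R by (auto simp: R_def)
  define \<epsilon> where "\<epsilon> = fpmat_dsum \<delta> (fpmat_dsum (fpmat_dsum \<epsilon>1 \<epsilon>2) (fpmat_dsum \<epsilon>3 \<epsilon>4))"
  have G\<epsilon>: "G d \<epsilon> = G d \<delta> \<inter> ((G d \<epsilon>1 \<inter> G d \<epsilon>2) \<inter> (G d \<epsilon>3 \<inter> G d \<epsilon>4))"
    by (simp add: \<epsilon>_def G_fpmat_dsum)
  have main: "invertible_mat (\<psi> x) \<and> op_bound (mat_inv (\<psi> x)) (2 * R)" if "x \<in> G d \<epsilon>" for x
  proof -
    from that have xG: "x \<in> G d \<delta>" "x \<in> G d \<epsilon>1" "x \<in> G d \<epsilon>2" "x \<in> G d \<epsilon>3" "x \<in> G d \<epsilon>4"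
      by (auto simp: G\<epsilon>)
    let ?n = "fst x"
    have x: "x \<in> Md d" using xG by (simp add: G_def)
    note cx = nc_function_carrier[OF nc xG(1)]
    note px = fpeval_carrier[OF x]
    have "op_bound (\<psi> x * fpeval q x - 1\<^sub>m ?n) (1 / 2)"
    proof (rule op_boundI_unit)
      fix v assume "v \<in> carrier_vec (dim_col (\<psi> x * fpeval q x - 1\<^sub>m ?n))" and v1: "vnorm v \<le> 1"
      then have v: "v \<in> carrier_vec ?n" by simp
      \<comment> \<open>\<open>L\<close> depends on \<open>x\<close> and \<open>v\<close>, whereas
        all constants above were fixed beforehand; this makes the estimate uniform.\<close>
      define L where "L = complex_of_real c \<cdot>\<^sub>m orbit_mat w ?r x v"
      note cL0 = orbit_mat_carrier[of w ?r x v]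
      have L: "L \<in> carrier_mat ?n ?r" using cL0 by (simp add: L_def)
      have Lu: "L *\<^sub>v y = complex_of_real c \<cdot>\<^sub>v (orbit_mat w ?r x v *\<^sub>v y)" if "y \<in> carrier_vec ?r" for y
        using that cL0 by (intro eq_vecI) (auto simp: L_def)
      \<comment> \<open>The relations are so small at \<open>x\<close> that the triangular point
        stays in \<open>G d \<delta>\<close> although \<open>L\<close> carries the factor
        \<open>c\<close>.\<close>
      have bT: "block_bound \<delta> (tri x L N) (\<rho> + real (?J * ?K * ?r) * (c * \<eta>))"
      proof (rule block_bound_tri[OF x N L \<epsilon>1(2)[OF xG(2)] bN])
        fix a b j assume abj: "a < ?J" "b < ?K" "j < ?r"
        let ?p = "\<delta> $$ (a, b)"
        have 1: "fpeval ?p x * L = complex_of_real c \<cdot>\<^sub>m (fpeval ?p x * orbit_mat w ?r x v)"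
          unfolding L_def by (rule mult_smult_distrib[OF px cL0])
        have 2: "L * fpeval ?p N = complex_of_real c \<cdot>\<^sub>m (orbit_mat w ?r x v * fpeval ?p N)"
          unfolding L_def by (rule mult_smult_assoc_mat[OF cL0 fpeval_carrier[OF N]])
        have "col (fpeval ?p x * L - L * fpeval ?p N) j
            = complex_of_real c \<cdot>\<^sub>v col (fpeval ?p x * orbit_mat w ?r x v - orbit_mat w ?r x v * fpeval ?p N) j"
          unfolding 1 2 using px[of ?p] fpeval_carrier[OF N, of ?p] cL0 abj
          by (intro eq_vecI) (auto simp: right_diff_distrib simp del: index_mult_mat(1))
        also have "\<dots> = complex_of_real c \<cdot>\<^sub>v (fpeval (module_relation w N ?p j) x *\<^sub>v v)"
          unfolding orbit_mat_defect[OF x N v abj(3)] ..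
        finally have "vnorm (col (fpeval ?p x * L - L * fpeval ?p N) j)
            = c * vnorm (fpeval (module_relation w N ?p j) x *\<^sub>v v)" using c by simp
        also have "vnorm (fpeval (module_relation w N ?p j) x *\<^sub>v v) \<le> \<eta>"
        proof -
          have "module_relation w N ?p j \<in> S" using abj by (force simp: S_def)
          then have "opnorm (fpeval (module_relation w N ?p j) x) \<le> \<eta>" using \<epsilon>2(2)[OF xG(3)] by force
          then have "op_bound (fpeval (module_relation w N ?p j) x) \<eta>" using opnorm_le_iff \<eta> by simp
          then have "vnorm (fpeval (module_relation w N ?p j) x *\<^sub>v v) \<le> \<eta> * vnorm v"
            using v x by (intro op_boundD) auto
          also have "\<dots> \<le> \<eta> * 1" using v1 \<eta> by (intro mult_left_mono) auto
          finally show ?thesis by simp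
        qed
        finally show "vnorm (col (fpeval ?p x * L - L * fpeval ?p N) j) \<le> c * \<eta>" using c by simp
      qed (use c \<eta> in simp)
      then have T: "tri x L N \<in> G d \<delta>"
        using small tri_Md[OF x N] unfolding mem_G_iff \<kappa>_def by blast
      have "\<psi> (tri x L N) = tri_mat (\<psi> x) L (\<psi> N)"
        by (rule nc_function_tri[OF nc G_subset_Md xG(1) NG dsum_mem_G[OF xG(1) NG] T L])
      then have "op_bound (tri_mat (\<psi> x) L (\<psi> N)) C" using C[OF T] by simp
      \<comment> \<open>The corner of the value of \<psi> carries the factor \<open>c\<close> too,
        while the value is bounded by \<open>C\<close>; dividing by \<open>c\<close> gives
        smallness.\<close>
      from tri_mat_corner_bound[OF cx cN L this u]
      have "vnorm (\<psi> x *\<^sub>v (L *\<^sub>v u) - L *\<^sub>v av) \<le> C * vnorm u" by (simp add: \<psi>u)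
      moreover have "\<psi> x *\<^sub>v (L *\<^sub>v u) - L *\<^sub>v av
          = complex_of_real c \<cdot>\<^sub>v (\<psi> x *\<^sub>v (fpeval q x *\<^sub>v v) - fpeval e x *\<^sub>v v)"
      proof -
        have qv: "fpeval q x *\<^sub>v v \<in> carrier_vec ?n" "fpeval e x *\<^sub>v v \<in> carrier_vec ?n"
          by (rule mult_mat_vec_carrier[OF px v])+
        have "L *\<^sub>v u = complex_of_real c \<cdot>\<^sub>v (fpeval q x *\<^sub>v v)"
          unfolding Lu[OF u] orbit_mat_mult_vec[OF x v u] q_def ..
        then have "\<psi> x *\<^sub>v (L *\<^sub>v u) = complex_of_real c \<cdot>\<^sub>v (\<psi> x *\<^sub>v (fpeval q x *\<^sub>v v))"
          using mult_mat_vec[OF cx qv(1)] by simp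
        moreover have "L *\<^sub>v av = complex_of_real c \<cdot>\<^sub>v (fpeval e x *\<^sub>v v)"
          unfolding Lu[OF av] orbit_mat_mult_vec[OF x v av] e_def ..
        ultimately show ?thesis
          using mult_mat_vec_carrier[OF cx qv(1)] qv cx x
          by (intro eq_vecI) (auto simp: right_diff_distrib simp del: index_mult_mat_vec)
      qed
      ultimately have "c * vnorm (\<psi> x *\<^sub>v (fpeval q x *\<^sub>v v) - fpeval e x *\<^sub>v v) \<le> C * vnorm u"
        using c by simp
      also have "C * vnorm u \<le> c * (1 / 4)" by (simp add: c_def)
      finally have b1: "vnorm (\<psi> x *\<^sub>v (fpeval q x *\<^sub>v v) - fpeval e x *\<^sub>v v) \<le> 1 / 4" using c by simp
      have b2: "vnorm (fpeval e x *\<^sub>v v - v) \<le> 1 / 4"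
      proof -
        have "fpeval g x *\<^sub>v v = fpeval e x *\<^sub>v v + (- 1 \<cdot>\<^sub>m 1\<^sub>m ?n) *\<^sub>v v"
          unfolding g_def fpeval.simps(3) fpeval_FConst
          by (rule add_mult_distrib_mat_vec[OF px _ v]) simp
        also have "(- 1 \<cdot>\<^sub>m 1\<^sub>m ?n) *\<^sub>v v = - 1 \<cdot>\<^sub>v v"
          using v by (intro eq_vecI) auto
        finally have "fpeval g x *\<^sub>v v = fpeval e x *\<^sub>v v - v"
          using mult_mat_vec_carrier[OF px v, of e] v by (auto intro!: eq_vecI simp del: index_mult_mat_vec)
        moreover have "op_bound (fpeval g x) (1 / 4)"
          using \<epsilon>3(2)[OF xG(4), of g] opnorm_le_iff[of "1 / 4" "fpeval g x"] by simp
        then have "vnorm (fpeval g x *\<^sub>v v) \<le> 1 / 4 * vnorm v" using v x by (intro op_boundD) auto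
        ultimately show ?thesis using v1 by simp
      qed
      have cq: "\<psi> x *\<^sub>v (fpeval q x *\<^sub>v v) \<in> carrier_vec ?n"
        by (rule mult_mat_vec_carrier[OF cx mult_mat_vec_carrier[OF px v]])
      have "(\<psi> x * fpeval q x - 1\<^sub>m ?n) *\<^sub>v v = \<psi> x *\<^sub>v (fpeval q x *\<^sub>v v) - v"
        using minus_mult_distrib_mat_vec[OF mult_carrier_mat[OF cx px] one_carrier_mat v]
          assoc_mult_mat_vec[OF cx px v] v by simp
      \<comment> \<open>Two errors of 1/4 add up to the 1/2 that \<open>approx_right_inverse\<close>
        allows.\<close>
      then show "vnorm ((\<psi> x * fpeval q x - 1\<^sub>m ?n) *\<^sub>v v) \<le> 1 / 2"
        using vnorm_diff_triangle[OF cq mult_mat_vec_carrier[OF px v, of e] v] b1 b2 by simp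
    qed simp
    moreover have "op_bound (fpeval q x) R"
      using \<epsilon>4(2)[OF xG(5), of q] opnorm_le_iff[of R "fpeval q x"] R by simp
    ultimately show ?thesis using approx_right_inverse[OF cx px] by blast
  qed
  show thesis
    by (rule that[of \<epsilon> "2 * R"]) (use main M \<epsilon>1 \<epsilon>2 \<epsilon>3 \<epsilon>4 in \<open>auto simp: G\<epsilon>\<close>)
qed

section \<open>Closure properties of bounded nc functions\<close>

lemma nc_function_subset: "nc_function \<Omega> \<phi> \<Longrightarrow> \<Omega>' \<subseteq> \<Omega> \<Longrightarrow> nc_function \<Omega>' \<phi>"
  unfolding nc_function_def by (meson subsetD)

lemma nc_function_cong:
  assumes "nc_function \<Omega> \<phi>" "\<And>x. x \<in> \<Omega> \<Longrightarrow> \<phi>' x = \<phi> x"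
  shows "nc_function \<Omega> \<phi>'"
  using assms unfolding nc_function_def by auto

lemma bounded_on_subset: "bounded_on \<Omega> \<phi> \<Longrightarrow> \<Omega>' \<subseteq> \<Omega> \<Longrightarrow> bounded_on \<Omega>' \<phi>"
  unfolding bounded_on_def by (meson subsetD)

lemma bounded_on_cong: "bounded_on \<Omega> \<phi> \<Longrightarrow> (\<And>x. x \<in> \<Omega> \<Longrightarrow> \<phi>' x = \<phi> x) \<Longrightarrow> bounded_on \<Omega> \<phi>'"
  unfolding bounded_on_def by auto

lemma bounded_on_iff: "bounded_on \<Omega> \<phi> \<longleftrightarrow> (\<exists>C. \<forall>x\<in>\<Omega>. op_bound (\<phi> x) C)"
proof
  assume "bounded_on \<Omega> \<phi>"
  then obtain C where C: "\<And>x. x \<in> \<Omega> \<Longrightarrow> opnorm (\<phi> x) \<le> C" by (auto simp: bounded_on_def)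
  then have "\<forall>x\<in>\<Omega>. op_bound (\<phi> x) C" using op_bound_mono op_bound_opnorm by blast
  then show "\<exists>C. \<forall>x\<in>\<Omega>. op_bound (\<phi> x) C" by blast
qed (auto simp: bounded_on_def intro: op_bound_imp_opnorm_le)

text \<open>A direct sum is the case \<open>L = 0\<close>, so its sum and product rules are
  inherited from those of \<open>tri_mat\<close>.\<close>

lemma diag_mat_eq_tri_mat:
  assumes "A \<in> carrier_mat n n" "B \<in> carrier_mat r r"
  shows "Defs.diag_mat A B = tri_mat A (0\<^sub>m n r) B"
  using assms by (intro tri_mat_intertwining[symmetric]) auto

lemma diag_mat_add:
  assumes "A \<in> carrier_mat n n" "A' \<in> carrier_mat n n" "B \<in> carrier_mat r r" "B' \<in> carrier_mat r r"
  shows "Defs.diag_mat A B + Defs.diag_mat A' B' = Defs.diag_mat (A + A') (B + B')"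
  using assms by (simp add: diag_mat_eq_tri_mat[of _ n _ r] tri_mat_add[of _ n _ _ r])

lemma diag_mat_mult:
  assumes "A \<in> carrier_mat n n" "A' \<in> carrier_mat n n" "B \<in> carrier_mat r r" "B' \<in> carrier_mat r r"
  shows "Defs.diag_mat A B * Defs.diag_mat A' B' = Defs.diag_mat (A * A') (B * B')"
  using assms by (simp add: diag_mat_eq_tri_mat[of _ n _ r] tri_mat_mult[of _ n _ _ r])

lemma diag_mat_one: "Defs.diag_mat (1\<^sub>m n) (1\<^sub>m r) = 1\<^sub>m (n + r)"
  by (simp add: Defs.diag_mat_def)

lemma diag_mat_smult:
  assumes "A \<in> carrier_mat n n" "B \<in> carrier_mat r r"
  shows "Defs.diag_mat (c \<cdot>\<^sub>m A) (c \<cdot>\<^sub>m B) = c \<cdot>\<^sub>m Defs.diag_mat A B"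
  using assms unfolding Defs.diag_mat_def by (intro eq_matI) auto

lemma diag_mat_carrier:
  assumes "A \<in> carrier_mat n n" "B \<in> carrier_mat r r"
  shows "Defs.diag_mat A B \<in> carrier_mat (n + r) (n + r)"
  using assms by (simp add: Defs.diag_mat_def)

lemma conj_mult:
  fixes A :: "complex mat"
  assumes "A \<in> carrier_mat n n" "B \<in> carrier_mat n n" "s \<in> carrier_mat n n" "t \<in> carrier_mat n n"
    "s * t = 1\<^sub>m n"
  shows "t * A * s * (t * B * s) = t * (A * B) * s"
proof -
  have "t * A * s * (t * B * s) = t * A * (s * (t * B * s))"
    using assms by (intro assoc_mult_mat[of _ n n _ n _ n]) auto
  also have "s * (t * B * s) = s * t * B * s"
    using assms assoc_mult_mat[of s n n t n B n] assoc_mult_mat[of s n n "t * B" n s n] by simp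
  also have "\<dots> = B * s" using assms by simp
  also have "t * A * (B * s) = t * (A * B) * s"
    using assms by (simp add: assoc_mult_mat[of _ n n _ n _ n])
  finally show ?thesis .
qed

lemma conj_add:
  fixes A :: "complex mat"
  assumes "A \<in> carrier_mat n n" "B \<in> carrier_mat n n" "s \<in> carrier_mat n n" "t \<in> carrier_mat n n"
  shows "t * (A + B) * s = t * A * s + t * B * s"
  using assms by (simp add: mult_add_distrib_mat[of _ n n _ n] add_mult_distrib_mat[of _ n n _ _ n])

lemma nc_functionI:
  assumes "\<And>x. x \<in> \<Omega> \<Longrightarrow> \<phi> x \<in> carrier_mat (fst x) (fst x)"
    and "\<And>x y. x \<in> \<Omega> \<Longrightarrow> y \<in> \<Omega> \<Longrightarrow> dsum x y \<in> \<Omega> \<Longrightarrow> \<phi> (dsum x y) = Defs.diag_mat (\<phi> x) (\<phi> y)"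
    and "\<And>x s t. x \<in> \<Omega> \<Longrightarrow> simil t s x \<in> \<Omega> \<Longrightarrow> s \<in> carrier_mat (fst x) (fst x) \<Longrightarrow>
      t \<in> carrier_mat (fst x) (fst x) \<Longrightarrow> t * s = 1\<^sub>m (fst x) \<Longrightarrow> s * t = 1\<^sub>m (fst x) \<Longrightarrow>
      \<phi> (simil t s x) = t * \<phi> x * s"
  shows "nc_function \<Omega> \<phi>"
  using assms unfolding nc_function_def by blast

lemma nc_function_dsum:
  "nc_function \<Omega> \<phi> \<Longrightarrow> x \<in> \<Omega> \<Longrightarrow> y \<in> \<Omega> \<Longrightarrow> dsum x y \<in> \<Omega> \<Longrightarrow> \<phi> (dsum x y) = Defs.diag_mat (\<phi> x) (\<phi> y)"
  unfolding nc_function_def by blast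

lemma nc_function_simil:
  "nc_function \<Omega> \<phi> \<Longrightarrow> x \<in> \<Omega> \<Longrightarrow> simil t s x \<in> \<Omega> \<Longrightarrow> s \<in> carrier_mat (fst x) (fst x) \<Longrightarrow>
    t \<in> carrier_mat (fst x) (fst x) \<Longrightarrow> t * s = 1\<^sub>m (fst x) \<Longrightarrow> s * t = 1\<^sub>m (fst x) \<Longrightarrow>
    \<phi> (simil t s x) = t * \<phi> x * s"
  unfolding nc_function_def by blast

lemma nc_function_add:
  assumes "nc_function \<Omega> \<phi>" "nc_function \<Omega> \<psi>"
  shows "nc_function \<Omega> (\<lambda>x. \<phi> x + \<psi> x)"
proof (rule nc_functionI)
  note c = nc_function_carrier[OF assms(1)] nc_function_carrier[OF assms(2)]
  show "\<phi> x + \<psi> x \<in> carrier_mat (fst x) (fst x)" if "x \<in> \<Omega>" for x using c that by simp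
  show "\<phi> (dsum x y) + \<psi> (dsum x y) = Defs.diag_mat (\<phi> x + \<psi> x) (\<phi> y + \<psi> y)"
    if "x \<in> \<Omega>" "y \<in> \<Omega>" "dsum x y \<in> \<Omega>" for x y
    unfolding nc_function_dsum[OF assms(1) that] nc_function_dsum[OF assms(2) that]
    using that by (intro diag_mat_add[of _ "fst x" _ _ "fst y"] c)
  show "\<phi> (simil t s x) + \<psi> (simil t s x) = t * (\<phi> x + \<psi> x) * s"
    if "x \<in> \<Omega>" "simil t s x \<in> \<Omega>" "s \<in> carrier_mat (fst x) (fst x)" "t \<in> carrier_mat (fst x) (fst x)"
      "t * s = 1\<^sub>m (fst x)" "s * t = 1\<^sub>m (fst x)" for x s t
    unfolding nc_function_simil[OF assms(1) that] nc_function_simil[OF assms(2) that]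
    using that by (intro conj_add[of _ "fst x", symmetric] c)
qed

lemma nc_function_mult:
  assumes "nc_function \<Omega> \<phi>" "nc_function \<Omega> \<psi>"
  shows "nc_function \<Omega> (\<lambda>x. \<phi> x * \<psi> x)"
proof (rule nc_functionI)
  note c = nc_function_carrier[OF assms(1)] nc_function_carrier[OF assms(2)]
  show "\<phi> x * \<psi> x \<in> carrier_mat (fst x) (fst x)" if "x \<in> \<Omega>" for x
    using c that by (intro mult_carrier_mat)
  show "\<phi> (dsum x y) * \<psi> (dsum x y) = Defs.diag_mat (\<phi> x * \<psi> x) (\<phi> y * \<psi> y)"
    if "x \<in> \<Omega>" "y \<in> \<Omega>" "dsum x y \<in> \<Omega>" for x y
    unfolding nc_function_dsum[OF assms(1) that] nc_function_dsum[OF assms(2) that]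
    using that by (intro diag_mat_mult[of _ "fst x" _ _ "fst y"] c)
  show "\<phi> (simil t s x) * \<psi> (simil t s x) = t * (\<phi> x * \<psi> x) * s"
    if "x \<in> \<Omega>" "simil t s x \<in> \<Omega>" "s \<in> carrier_mat (fst x) (fst x)" "t \<in> carrier_mat (fst x) (fst x)"
      "t * s = 1\<^sub>m (fst x)" "s * t = 1\<^sub>m (fst x)" for x s t
    unfolding nc_function_simil[OF assms(1) that] nc_function_simil[OF assms(2) that]
    using that by (intro conj_mult[of _ "fst x"] c)
qed

lemma nc_function_smult:
  assumes "nc_function \<Omega> \<phi>"
  shows "nc_function \<Omega> (\<lambda>x. a \<cdot>\<^sub>m \<phi> x)"
proof (rule nc_functionI)
  note c = nc_function_carrier[OF assms(1)]
  show "a \<cdot>\<^sub>m \<phi> x \<in> carrier_mat (fst x) (fst x)" if "x \<in> \<Omega>" for x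
    using c that by simp
  show "a \<cdot>\<^sub>m \<phi> (dsum x y) = Defs.diag_mat (a \<cdot>\<^sub>m \<phi> x) (a \<cdot>\<^sub>m \<phi> y)"
    if "x \<in> \<Omega>" "y \<in> \<Omega>" "dsum x y \<in> \<Omega>" for x y
    unfolding nc_function_dsum[OF assms(1) that]
    using that by (intro diag_mat_smult[of _ "fst x" _ "fst y", symmetric] c)
  show "a \<cdot>\<^sub>m \<phi> (simil t s x) = t * (a \<cdot>\<^sub>m \<phi> x) * s"
    if "x \<in> \<Omega>" "simil t s x \<in> \<Omega>" "s \<in> carrier_mat (fst x) (fst x)" "t \<in> carrier_mat (fst x) (fst x)"
      "t * s = 1\<^sub>m (fst x)" "s * t = 1\<^sub>m (fst x)" for x s t
    unfolding nc_function_simil[OF assms(1) that] mult_smult_distrib[OF that(4) c[OF that(1)]]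
    by (rule mult_smult_assoc_mat[OF mult_carrier_mat[OF that(4) c[OF that(1)]] that(3), symmetric])
qed

text \<open>The expected values multiply with the values of \<phi> to the identity on both sides, so
  \<open>mat_inv_eqI\<close> identifies them as the inverses.\<close>

lemma nc_function_mat_inv:
  assumes "nc_function \<Omega> \<phi>" and inv: "\<And>x. x \<in> \<Omega> \<Longrightarrow> invertible_mat (\<phi> x)"
  shows "nc_function \<Omega> (\<lambda>x. mat_inv (\<phi> x))"
proof (rule nc_functionI)
  note c = nc_function_carrier[OF assms(1)]
  note i = mat_inv_props[OF c inv]
  show "mat_inv (\<phi> x) \<in> carrier_mat (fst x) (fst x)" if "x \<in> \<Omega>" for x
    using i(1) that by simp
  show "mat_inv (\<phi> (dsum x y)) = Defs.diag_mat (mat_inv (\<phi> x)) (mat_inv (\<phi> y))"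
    if x: "x \<in> \<Omega>" and y: "y \<in> \<Omega>" and xy: "dsum x y \<in> \<Omega>" for x y
    unfolding nc_function_dsum[OF assms(1) that]
    using diag_mat_mult[OF c[OF x] i(1)[OF x x] c[OF y] i(1)[OF y y]]
      diag_mat_mult[OF i(1)[OF x x] c[OF x] i(1)[OF y y] c[OF y]]
    by (intro mat_inv_eqI[of _ "fst x + fst y"] diag_mat_carrier c i x y)
      (simp_all add: i x y diag_mat_one)
  show "mat_inv (\<phi> (simil t s x)) = t * mat_inv (\<phi> x) * s"
    if x: "x \<in> \<Omega>" "simil t s x \<in> \<Omega>" and s: "s \<in> carrier_mat (fst x) (fst x)"
      and t: "t \<in> carrier_mat (fst x) (fst x)"
      and ts: "t * s = 1\<^sub>m (fst x)" and st: "s * t = 1\<^sub>m (fst x)" for x s t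
    unfolding nc_function_simil[OF assms(1) that]
  proof (rule mat_inv_eqI)
    let ?n = "fst x"
    note ix = i[OF x(1) x(1)]
    show "t * \<phi> x * s \<in> carrier_mat ?n ?n" "t * mat_inv (\<phi> x) * s \<in> carrier_mat ?n ?n"
      using s t c[OF x(1)] ix(1) by simp_all
    show "t * \<phi> x * s * (t * mat_inv (\<phi> x) * s) = 1\<^sub>m ?n"
      unfolding conj_mult[OF c[OF x(1)] ix(1) s t st] ix(2) using t ts by simp
    show "t * mat_inv (\<phi> x) * s * (t * \<phi> x * s) = 1\<^sub>m ?n"
      unfolding conj_mult[OF ix(1) c[OF x(1)] s t st] ix(3) using t ts by simp
  qed
qed

lemma bounded_on_add:
  assumes "nc_function \<Omega> \<phi>" "nc_function \<Omega> \<psi>" "bounded_on \<Omega> \<phi>" "bounded_on \<Omega> \<psi>"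
  shows "bounded_on \<Omega> (\<lambda>x. \<phi> x + \<psi> x)"
  using assms(3,4) op_bound_add[OF nc_function_carrier[OF assms(1)] nc_function_carrier[OF assms(2)]]
  unfolding bounded_on_iff by meson

lemma bounded_on_mult:
  assumes "nc_function \<Omega> \<phi>" "nc_function \<Omega> \<psi>" "bounded_on \<Omega> \<phi>" "bounded_on \<Omega> \<psi>"
  shows "bounded_on \<Omega> (\<lambda>x. \<phi> x * \<psi> x)"
  using assms(3,4) op_bound_mult[OF nc_function_carrier[OF assms(1)] nc_function_carrier[OF assms(2)]]
  unfolding bounded_on_iff by meson

lemma bounded_on_smult: "bounded_on \<Omega> \<phi> \<Longrightarrow> bounded_on \<Omega> (\<lambda>x. a \<cdot>\<^sub>m \<phi> x)"
  unfolding bounded_on_iff using op_bound_smult by meson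

section \<open>Induction on the presentation\<close>

definition regular_at :: "nat \<Rightarrow> point set \<Rightarrow> mexpr \<Rightarrow> point \<Rightarrow> bool" where
  "regular_at d D e M \<longleftrightarrow> (\<exists>\<delta>. M \<in> G d \<delta> \<and> G d \<delta> \<subseteq> D \<and> (\<forall>x\<in>G d \<delta>. meval e x \<noteq> None) \<and>
     nc_function (G d \<delta>) (mfun e) \<and> bounded_on (G d \<delta>) (mfun e))"

lemma mfun_simps:
  "meval a x \<noteq> None \<Longrightarrow> meval b x \<noteq> None \<Longrightarrow> mfun (MAdd a b) x = mfun a x + mfun b x"
  "meval a x \<noteq> None \<Longrightarrow> meval b x \<noteq> None \<Longrightarrow> mfun (MMul a b) x = mfun a x * mfun b x"
  "meval a x \<noteq> None \<Longrightarrow> mfun (MScal c a) x = c \<cdot>\<^sub>m mfun a x"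
  "meval a x \<noteq> None \<Longrightarrow> invertible_mat (mfun a x) \<Longrightarrow> mfun (MInv a) x = mat_inv (mfun a x)"
  by (auto simp: mfun_def)

lemma meval_MInv_defined:
  "meval (MInv a) x \<noteq> None \<longleftrightarrow> meval a x \<noteq> None \<and> invertible_mat (mfun a x)"
  by (auto simp: mfun_def split: option.splits)

lemma regular_at_common:
  assumes "regular_at d D a M" "regular_at d D b M"
  obtains \<delta> where "M \<in> G d \<delta>" "G d \<delta> \<subseteq> D"
    "\<And>x. x \<in> G d \<delta> \<Longrightarrow> meval a x \<noteq> None" "\<And>x. x \<in> G d \<delta> \<Longrightarrow> meval b x \<noteq> None"
    "nc_function (G d \<delta>) (mfun a)" "nc_function (G d \<delta>) (mfun b)"
    "bounded_on (G d \<delta>) (mfun a)" "bounded_on (G d \<delta>) (mfun b)"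
proof -
  from assms(1) obtain \<delta> where \<delta>: "M \<in> G d \<delta>" "G d \<delta> \<subseteq> D" "\<And>x. x \<in> G d \<delta> \<Longrightarrow> meval a x \<noteq> None"
    "nc_function (G d \<delta>) (mfun a)" "bounded_on (G d \<delta>) (mfun a)"
    unfolding regular_at_def by blast
  from assms(2) obtain \<epsilon> where \<epsilon>: "M \<in> G d \<epsilon>" "G d \<epsilon> \<subseteq> D" "\<And>x. x \<in> G d \<epsilon> \<Longrightarrow> meval b x \<noteq> None"
    "nc_function (G d \<epsilon>) (mfun b)" "bounded_on (G d \<epsilon>) (mfun b)"
    unfolding regular_at_def by blast
  have sub: "G d \<delta> \<inter> G d \<epsilon> \<subseteq> G d \<delta>" "G d \<delta> \<inter> G d \<epsilon> \<subseteq> G d \<epsilon>" by auto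
  show thesis
    by (rule that[of "fpmat_dsum \<delta> \<epsilon>"], unfold G_fpmat_dsum)
      (use \<delta> \<epsilon> nc_function_subset[OF \<delta>(4) sub(1)] nc_function_subset[OF \<epsilon>(4) sub(2)]
        bounded_on_subset[OF \<delta>(5) sub(1)] bounded_on_subset[OF \<epsilon>(5) sub(2)] in auto)
qed

lemma regular_atI:
  assumes "M \<in> G d \<delta>" "G d \<delta> \<subseteq> D" "\<And>x. x \<in> G d \<delta> \<Longrightarrow> meval e x \<noteq> None"
    and "nc_function (G d \<delta>) \<phi>" "bounded_on (G d \<delta>) \<phi>" "\<And>x. x \<in> G d \<delta> \<Longrightarrow> mfun e x = \<phi> x"
  shows "regular_at d D e M"
  unfolding regular_at_def
  using assms(1-3) nc_function_cong[OF assms(4,6)] bounded_on_cong[OF assms(5,6)] by blast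

text \<open>Definedness at \<open>M\<close> passes to the subexpressions. Sums and products are
  treated on the intersection of two neighbourhoods, inversion on the smaller one from
  \<open>nc_function_inverse_bounded\<close>. Definedness on a whole neighbourhood is carried
  through the induction, since subexpressions are evaluated at all nearby points.\<close>

lemma regular_at_defined:
  assumes "\<And>f. f \<in> leaves e \<Longrightarrow> free_holomorphic d D f" "M \<in> D" "meval e M \<noteq> None"
  shows "regular_at d D e M"
  using assms
proof (induction e)
  case (MHol f)
  then obtain \<delta> where "M \<in> G d \<delta>" "G d \<delta> \<subseteq> D" "nc_function (G d \<delta>) f" "bounded_on (G d \<delta>) f"
    by (auto simp: free_holomorphic_def)
  then show ?case by (intro regular_atI[of M d \<delta> D _ f]) (auto simp: mfun_def)
next
  case (MAdd a b)
  then have "meval a M \<noteq> None" "meval b M \<noteq> None" by (auto split: option.splits)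
  then have "regular_at d D a M" "regular_at d D b M" using MAdd by auto
  then obtain \<delta> where \<delta>: "M \<in> G d \<delta>" "G d \<delta> \<subseteq> D"
    "\<And>x. x \<in> G d \<delta> \<Longrightarrow> meval a x \<noteq> None" "\<And>x. x \<in> G d \<delta> \<Longrightarrow> meval b x \<noteq> None"
    "nc_function (G d \<delta>) (mfun a)" "nc_function (G d \<delta>) (mfun b)"
    "bounded_on (G d \<delta>) (mfun a)" "bounded_on (G d \<delta>) (mfun b)" by (rule regular_at_common) blast
  show ?case
  proof (rule regular_atI[OF \<delta>(1,2)])
    show "meval (MAdd a b) x \<noteq> None" if "x \<in> G d \<delta>" for x using \<delta>(3,4)[OF that] by auto
    show "mfun (MAdd a b) x = mfun a x + mfun b x" if "x \<in> G d \<delta>" for x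
      by (rule mfun_simps(1)[OF \<delta>(3,4)[OF that]])
  qed (rule nc_function_add[OF \<delta>(5,6)] bounded_on_add[OF \<delta>(5-8)])+
next
  case (MMul a b)
  then have "meval a M \<noteq> None" "meval b M \<noteq> None" by (auto split: option.splits)
  then have "regular_at d D a M" "regular_at d D b M" using MMul by auto
  then obtain \<delta> where \<delta>: "M \<in> G d \<delta>" "G d \<delta> \<subseteq> D"
    "\<And>x. x \<in> G d \<delta> \<Longrightarrow> meval a x \<noteq> None" "\<And>x. x \<in> G d \<delta> \<Longrightarrow> meval b x \<noteq> None"
    "nc_function (G d \<delta>) (mfun a)" "nc_function (G d \<delta>) (mfun b)"
    "bounded_on (G d \<delta>) (mfun a)" "bounded_on (G d \<delta>) (mfun b)" by (rule regular_at_common) blast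
  show ?case
  proof (rule regular_atI[OF \<delta>(1,2)])
    show "meval (MMul a b) x \<noteq> None" if "x \<in> G d \<delta>" for x using \<delta>(3,4)[OF that] by auto
    show "mfun (MMul a b) x = mfun a x * mfun b x" if "x \<in> G d \<delta>" for x
      by (rule mfun_simps(2)[OF \<delta>(3,4)[OF that]])
  qed (rule nc_function_mult[OF \<delta>(5,6)] bounded_on_mult[OF \<delta>(5-8)])+
next
  case (MScal c a)
  then have "regular_at d D a M" by auto
  then obtain \<delta> where \<delta>: "M \<in> G d \<delta>" "G d \<delta> \<subseteq> D" "\<And>x. x \<in> G d \<delta> \<Longrightarrow> meval a x \<noteq> None"
    "nc_function (G d \<delta>) (mfun a)" "bounded_on (G d \<delta>) (mfun a)" unfolding regular_at_def by blast
  show ?case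
  proof (rule regular_atI[OF \<delta>(1,2)])
    show "meval (MScal c a) x \<noteq> None" if "x \<in> G d \<delta>" for x using \<delta>(3)[OF that] by auto
    show "mfun (MScal c a) x = c \<cdot>\<^sub>m mfun a x" if "x \<in> G d \<delta>" for x
      by (rule mfun_simps(3)[OF \<delta>(3)[OF that]])
  qed (rule nc_function_smult[OF \<delta>(4)] bounded_on_smult[OF \<delta>(5)])+
next
  case (MInv a)
  have aM: "meval a M \<noteq> None" "invertible_mat (mfun a M)"
    using MInv.prems(3) unfolding meval_MInv_defined by auto
  then have "regular_at d D a M" using MInv by auto
  then obtain \<delta> where \<delta>: "M \<in> G d \<delta>" "G d \<delta> \<subseteq> D" "\<And>x. x \<in> G d \<delta> \<Longrightarrow> meval a x \<noteq> None"
    "nc_function (G d \<delta>) (mfun a)" "bounded_on (G d \<delta>) (mfun a)" unfolding regular_at_def by blast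
  obtain \<epsilon> R where \<epsilon>: "M \<in> G d \<epsilon>" "G d \<epsilon> \<subseteq> G d \<delta>"
    "\<And>x. x \<in> G d \<epsilon> \<Longrightarrow> invertible_mat (mfun a x) \<and> op_bound (mat_inv (mfun a x)) R"
    using nc_function_inverse_bounded[OF \<delta>(4,5,1) aM(2)] by blast
  show ?case
  proof (rule regular_atI[OF \<epsilon>(1) order_trans[OF \<epsilon>(2) \<delta>(2)]])
    show "meval (MInv a) x \<noteq> None" if "x \<in> G d \<epsilon>" for x
      unfolding meval_MInv_defined using \<epsilon> \<delta>(3) that by blast
    show "mfun (MInv a) x = mat_inv (mfun a x)" if "x \<in> G d \<epsilon>" for x
      using \<epsilon> \<delta>(3) that by (intro mfun_simps(4)) blast+
    show "nc_function (G d \<epsilon>) (\<lambda>x. mat_inv (mfun a x))"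
      using nc_function_subset[OF \<delta>(4) \<epsilon>(2)] \<epsilon>(3) by (intro nc_function_mat_inv) auto
    show "bounded_on (G d \<epsilon>) (\<lambda>x. mat_inv (mfun a x))"
      unfolding bounded_on_iff using \<epsilon>(3) by blast
  qed
qed

theorem theorem10p1:
  fixes d :: nat and D :: "point set" and e :: mexpr
  assumes "free_domain d D"
    and "is_meromorphic d D e"
  shows "\<forall>M \<in> D - singular_set D e. \<exists>\<delta>.
           M \<in> G d \<delta> \<and> G d \<delta> \<subseteq> D - singular_set D e \<and>
           nc_function (G d \<delta>) (mfun e) \<and> bounded_on (G d \<delta>) (mfun e)"
proof
  fix M assume "M \<in> D - singular_set D e"
  then have M: "M \<in> D" "meval e M \<noteq> None" by (auto simp: singular_set_def)
  \<comment> \<open>That \<open>e\<close> is defined at every point of the neighbourhood keeps it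
    disjoint from the singular set.\<close>
  have "regular_at d D e M"
    using assms(2) M by (intro regular_at_defined) (auto simp: is_meromorphic_def)
  then show "\<exists>\<delta>. M \<in> G d \<delta> \<and> G d \<delta> \<subseteq> D - singular_set D e \<and>
      nc_function (G d \<delta>) (mfun e) \<and> bounded_on (G d \<delta>) (mfun e)"
    unfolding regular_at_def singular_set_def by blast
qed

end
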